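(* Let $a,b,a',b'$ be integers with $ab'-a'b\equiv 1 \pmod 6$, and let $B$ and $B'$ denote the eigenbases of the operators $X^aZ^b$ and $X^{a'}Z^{b'}$ on $\mathbb{C}^6$, respectively. Then there are exactly $48$ normalized vectors $|v\rangle\in\mathbb{C}^6$ with first component $v_1=1/\sqrt6$ such that $$|\langle w|v\rangle|^2=\tfrac16\qquad\text{for all } |w\rangle\in B\cup B' .$$ From these $48$ vectors one can construct $16$ different orthonormal bases $B_i$ $(i=1,\dots,16)$ such that the three bases $B,B',B_i$ are mutually unbiased. All the triples $\{B,B',B_i\}$ are maximal in the sense that there is no vector $|\psi\rangle\in\mathbb{C}^6$ that is unbiased with respect to all three bases $B,B',B_i$.
   Context: On $\mathbb{C}^6$ with standard basis $|0\rangle,\dots,|5\rangle$, let $\omega_6=\exp(2\pi i/6)$, $X=\sum_{j=0}^{5}|j+1 \bmod 6\rangle\langle j|$ and $Z=\sum_{j=0}^{5}\omega_6^j|j\rangle\langle j|$. A vector of $\mathbb{C}^6$ is written $|v\rangle=(v_1,\dots,v_6)^t$ in the standard basis. The eigenbasis of an operator is its orthonormal basis of eigenvectors. Orthonormal bases $B,B'$ of $\mathbb{C}^d$ are mutually unbiased if $|\langle\psi|\psi'\rangle|^2=1/d$ for all $|\psi\rangle\in B$, $|\psi'\rangle\in B'$. A vector $|\psi\rangle\in\mathbb{C}^d$ is unbiased with respect to a set of vectors if $|\langle\psi|\psi_k\rangle|^2=1/d$ for every $|\psi_k\rangle$ in the set.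
   Formalization: The condition v_1=1/√6 is kept only when a or a' is 0 mod 6; in general the 48 vectors are counted up to a global phase (one representative per phase class), since e.g. for X and XZ the standard basis vectors are solutions with |v_1| equal to 0 or 1. *)

theory Defs
  imports "HOL-Analysis.Analysis" "HOL-Number_Theory.Cong"
begin

definition braket :: "complex ^ 'n \<Rightarrow> complex ^ 'n \<Rightarrow> complex"
  where "braket u v = (\<Sum>i\<in>UNIV. cnj (u $ i) * v $ i)"

definition orthonormal_basis :: "(complex ^ 'n) set \<Rightarrow> bool"
  where "orthonormal_basis B \<longleftrightarrow>
    (\<forall>u\<in>B. \<forall>v\<in>B. braket u v = (if u = v then 1 else 0)) \<and> vec.span B = UNIV"

definition eigenvector :: "complex ^ 'n ^ 'n \<Rightarrow> complex ^ 'n \<Rightarrow> bool"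
  where "eigenvector A v \<longleftrightarrow> v \<noteq> 0 \<and> (\<exists>c. A *v v = c *s v)"

text \<open>For an operator with simple spectrum the eigenbasis is determined only up to the order of
  its vectors and up to a phase for each of them, hence a predicate and not a function.\<close>

definition eigenbasis :: "complex ^ 'n ^ 'n \<Rightarrow> (complex ^ 'n) set \<Rightarrow> bool"
  where "eigenbasis A B \<longleftrightarrow> orthonormal_basis B \<and> (\<forall>v\<in>B. eigenvector A v)"

definition unbiased :: "complex ^ 'n \<Rightarrow> (complex ^ 'n) set \<Rightarrow> bool"
  where "unbiased v S \<longleftrightarrow> (\<forall>w\<in>S. (cmod (braket w v))\<^sup>2 = 1 / real CARD('n))"

definition mutually_unbiased :: "(complex ^ 'n) set \<Rightarrow> (complex ^ 'n) set \<Rightarrow> bool"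
  where "mutually_unbiased B C \<longleftrightarrow>
    (\<forall>u\<in>B. \<forall>v\<in>C. (cmod (braket u v))\<^sup>2 = 1 / real CARD('n))"

text \<open>\<open>V\<close> contains exactly one vector out of each class of vectors of \<open>S\<close> that agree up to a
  global phase. Fixing the first component to be \<open>1 / sqrt d\<close> yields such a \<open>V\<close> only if that
  component has modulus \<open>1 / sqrt d\<close> on all of \<open>S\<close>. This holds for vectors unbiased with respect to
  the standard basis, but fails for instance for the vectors unbiased with respect to the
  eigenbases of \<open>X\<close> and \<open>X Z\<close>, which include the standard basis vectors.\<close>

definition phase_representatives :: "(complex ^ 'n) set \<Rightarrow> (complex ^ 'n) set \<Rightarrow> bool"
  where "phase_representatives S V \<longleftrightarrow>
    V \<subseteq> S \<and> (\<forall>v\<in>S. \<exists>!u. u \<in> V \<and> (\<exists>c. cmod c = 1 \<and> v = c *s u))"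

lemma phase_representatives_exist:
  fixes S :: "(complex ^ 'n) set"
  shows "\<exists>V. phase_representatives S V"
proof -
  define E where "E u v \<longleftrightarrow> (\<exists>c. cmod c = 1 \<and> v = c *s u)" for u v :: "complex ^ 'n"
  have refl: "E u u" for u
    unfolding E_def by (rule exI[of _ 1]) simp
  have sym: "E v u" if "E u v" for u v
  proof -
    from that obtain c where c: "cmod c = 1" "v = c *s u" unfolding E_def by blast
    hence "c \<noteq> 0" by auto
    thus ?thesis unfolding E_def using c
      by (intro exI[of _ "inverse c"]) (simp add: norm_inverse)
  qed
  have trans: "E u w" if "E u v" "E v w" for u v w
  proof -
    from that obtain c d where "cmod c = 1" "v = c *s u" "cmod d = 1" "w = d *s v"
      unfolding E_def by blast
    thus ?thesis unfolding E_def by (intro exI[of _ "d * c"]) (simp add: norm_mult)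
  qed
  define r where "r v = (SOME u. u \<in> S \<and> E u v)" for v
  have r: "r v \<in> S \<and> E (r v) v" if "v \<in> S" for v
    unfolding r_def by (rule someI[of _ v]) (use that refl in blast)
  have r_eq: "r u = r v" if "E u v" for u v
  proof -
    have "E x u \<longleftrightarrow> E x v" for x using that sym trans by blast
    thus ?thesis unfolding r_def by simp
  qed
  have "phase_representatives S (r ` S)"
    unfolding phase_representatives_def E_def[symmetric]
  proof (intro conjI ballI)
    show "r ` S \<subseteq> S" using r by blast
    fix v assume v: "v \<in> S"
    show "\<exists>!u. u \<in> r ` S \<and> E u v"
    proof (rule ex1I[of _ "r v"])
      show "r v \<in> r ` S \<and> E (r v) v" using r v by blast
      fix u assume u: "u \<in> r ` S \<and> E u v"
      then obtain x where x: "x \<in> S" "u = r x" by blast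
      have "E x v" using x u r sym trans by blast
      thus "u = r v" using r_eq x by blast
    qed
  qed
  thus ?thesis by blast
qed

definition mat_power :: "complex ^ 'n ^ 'n \<Rightarrow> nat \<Rightarrow> complex ^ 'n ^ 'n"
  where "mat_power A n = (((**) A) ^^ n) (mat 1)"

definition mat_powi :: "complex ^ 'n ^ 'n \<Rightarrow> int \<Rightarrow> complex ^ 'n ^ 'n"
  where "mat_powi A k =
    (if k \<ge> 0 then mat_power A (nat k) else mat_power (matrix_inv A) (nat (- k)))"

text \<open>The standard basis is indexed by the numeral type \<open>6\<close>, whose elements are \<open>0, \<dots>, 5\<close> with
  addition modulo 6. In particular the first component of \<open>v\<close> is \<open>v $ 0\<close>.
  The function \<open>Rep_bit0\<close> gives the representative in \<open>{0..<6}\<close> of such an index.\<close>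

definition omega6 :: complex
  where "omega6 = exp (2 * complex_of_real pi * \<i> / 6)"

definition X6 :: "complex ^ 6 ^ 6"
  where "X6 = (\<chi> i j. if i = j + 1 then 1 else 0)"

definition Z6 :: "complex ^ 6 ^ 6"
  where "Z6 = (\<chi> i j. if i = j then omega6 ^ nat (Rep_bit0 j) else 0)"

definition bases_within :: "(complex ^ 'n) set \<Rightarrow> (complex ^ 'n) set set"
  where "bases_within V = {C. C \<subseteq> V \<and> orthonormal_basis C}"

end

theory Submission
  imports Defs
begin

text \<open>If \<open>A u = \<lambda> u\<close> for \<open>A = X\<^sup>a Z\<^sup>b\<close>, then \<open>A' = X\<^bsup>a'\<^esup> Z\<^bsup>b'\<^esup>\<close> permutes the eigenvectors of \<open>A\<close> cyclically
  because \<open>A A'\<close> and \<open>A' A\<close> differ by a primitive sixth root of unity. In suitable phases these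
  eigenvectors form a frame in which \<open>B\<close> is the standard basis and \<open>B'\<close> the Fourier basis, so the
  vectors in question are those with unimodular coordinates and a unimodular Fourier transform.

  Split indices as \<open>\<int>\<^sub>6 = \<int>\<^sub>2 \<times> \<int>\<^sub>3\<close> and write the two coordinates over \<open>s \<in> \<int>\<^sub>3\<close> as \<open>y\<^sub>s z\<^sub>s\<close> and
  \<open>y\<^sub>s cnj z\<^sub>s\<close>. With \<open>u\<^sub>s = y\<^bsub>s+1\<^esub> cnj y\<^sub>s\<close>, the conditions say that both \<open>c\<^sub>s = Re z\<^sub>s\<close> and
  \<open>c\<^sub>s = Im z\<^sub>s\<close> satisfy \<open>\<Sum> c\<^sub>s\<^sup>2 = 3/2\<close> and \<open>\<Sum> c\<^sub>s c\<^bsub>s+1\<^esub> u\<^sub>s = 0\<close>. If the \<open>u\<^sub>s\<close> are not all real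
  multiples of one of them, the two real relations between them are proportional, which makes all
  \<open>z\<^sub>s\<close> equal to a primitive eighth root of unity up to sign (12 solutions). Otherwise, after sign
  changes, all \<open>u\<^sub>s\<close> are the same cube root of unity, and up to an eighth root of unity the \<open>z\<^sub>s\<close> are
  the roots \<open>1, d, 1/d\<close> of a cubic with sum \<open>\<surd>3\<close> (36 solutions). All inner products of the
  solutions are computed exactly over \<open>1, \<surd>3, \<beta>, \<surd>3 \<beta>\<close> with \<open>\<beta>\<^sup>2 = \<surd>3/2\<close>; a finite enumeration
  then yields 16 orthonormal bases, and each of the 48 vectors lies in a given basis or is orthogonal
  to one of its members.\<close>

subsection \<open>Enumeration of the codes and of their cliques\<close>

datatype quad = Quad int int int int

fun quad_plus :: "quad \<Rightarrow> quad \<Rightarrow> quad" where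
  "quad_plus (Quad a b c d) (Quad a' b' c' d') = Quad (a + a') (b + b') (c + c') (d + d')"

text \<open>The code \<open>(q, [(n\<^sub>0, m\<^sub>0), (n\<^sub>1, m\<^sub>1), (n\<^sub>2, m\<^sub>2)])\<close> stands for the solution with
  \<open>y\<^sub>s = w^n\<^sub>s\<close>, \<open>w\<close> the cube root of unity, and \<open>z\<^sub>s = exp (\<plusminus>\<i>\<pi>/4) d^m\<^sub>s\<close>, with sign \<open>q\<close>.
  \<open>Quad a b c d\<close> stands for \<open>a + b \<surd>3 + (c + d \<surd>3) \<beta>\<close>, and \<open>re_table\<close> lists twice the real
  parts of \<open>cnj z\<^sub>s z'\<^sub>s\<close>. The inner product of two solutions is a multiple of
  \<open>part 0 + w part 1 + w\<^sup>2 part 2\<close>, which vanishes iff the three parts agree.\<close>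

type_synonym code = "bool \<times> (int \<times> int) list"

definition re_table :: "bool \<Rightarrow> bool \<Rightarrow> int \<Rightarrow> quad" where
  "re_table q q' k = (if q = q' then
     (if k = 0 then Quad 2 0 0 0 else if k = 1 \<or> k = -1 then Quad (-1) 1 0 0 else Quad 2 (-2) 0 0)
    else let k' = (if q then k else - k) in
     (if k' = 0 then Quad 0 0 0 0 else if k' = 1 then Quad 0 0 2 0 else if k' = -1 then Quad 0 0 (-2) 0
      else if k' = 2 then Quad 0 0 (-2) 2 else Quad 0 0 2 (-2)))"

definition part :: "int \<Rightarrow> code \<Rightarrow> code \<Rightarrow> quad" where
  "part i c c' = foldr quad_plus (map (\<lambda>((n,m),(n',m')).
     if (n' - n) mod 3 = i then re_table (fst c) (fst c') (m' - m) else Quad 0 0 0 0)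
     (zip (snd c) (snd c'))) (Quad 0 0 0 0)"

definition orth :: "code \<Rightarrow> code \<Rightarrow> bool" where
  "orth c c' \<longleftrightarrow> part 0 c c' = part 1 c c' \<and> part 1 c c' = part 2 c c'"

text \<open>Three of the nine pairs \<open>(n, n')\<close> continue 0 to an arithmetic progression
  modulo 3 and admit six exponent triples each; the other six pairs admit one. With both signs this
  makes 2 * (3 * 6 + 6) = 48.\<close>

definition codes :: "code list" where
  "codes = concat (map (\<lambda>q. concat (map (\<lambda>n. concat (map (\<lambda>n'.
      map (\<lambda>(m, m', m''). (q, [(0, m), (n, m'), (n', m'')]))
        (if n' = (2 * n) mod 3 then [(0,1,-1), (0,-1,1), (1,0,-1), (-1,0,1), (1,-1,0), (-1,1,0)]
         else [(0,0,0)]))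
      [0,1,2])) [0,1,2])) [True,False])"

section \<open>Cliques of a relation on a list\<close>

fun cliques :: "('a \<Rightarrow> 'a \<Rightarrow> bool) \<Rightarrow> nat \<Rightarrow> 'a list \<Rightarrow> 'a list list" where
  "cliques adj 0 xs = [[]]"
| "cliques adj (Suc k) [] = []"
| "cliques adj (Suc k) (x # xs) = map ((#) x) (cliques adj k (filter (adj x) xs)) @ cliques adj (Suc k) xs"

lemma length_codes: "length codes = 48" by code_simp

lemma distinct_codes: "distinct codes" by code_simp

lemma length_cliques: "length (cliques orth 6 codes) = 16" by code_simp

text \<open>The finite check behind maximality: a vector unbiased to the first two bases is a phase
  times a solution, so it has squared overlap 0 or 1, never 1/6, with some member of each third
  basis.\<close>

lemma cliques_maximal:
  "\<forall>K\<in>set (cliques orth 6 codes). \<forall>c\<in>set codes. \<exists>k\<in>set K. k = c \<or> orth k c" by code_simp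

text \<open>A code can be recovered from its orthogonality pattern alone. This shows that different
  codes give non-proportional vectors without comparing components.\<close>

lemma orth_separates:
  "distinct (map (\<lambda>c. map (\<lambda>k. orth k c) codes) codes)" by code_simp

text \<open>The enumeration tests each element only against later ones in the list, so symmetry of
  \<open>adj\<close> supplies the reverse tests.\<close>

lemma set_cliques:
  assumes "distinct xs" "\<And>x y. x \<in> set xs \<Longrightarrow> y \<in> set xs \<Longrightarrow> adj x y \<longleftrightarrow> adj y x"
  shows "set ` set (cliques adj k xs) =
    {K. K \<subseteq> set xs \<and> card K = k \<and> (\<forall>x\<in>K. \<forall>y\<in>K. x \<noteq> y \<longrightarrow> adj x y)}"
    (is "_ = ?R k xs")
  using assms
proof (induction adj k xs rule: cliques.induct)
  case (1 adj xs)
  have "card K = 0 \<longleftrightarrow> K = {}" if "K \<subseteq> set xs" for K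
    using finite_subset[OF that] by simp
  then show ?case by auto
next
  case (2 adj k)
  then show ?case by auto
next
  case (3 adj k x xs)
  let ?R = "\<lambda>k xs. {K. K \<subseteq> set xs \<and> card K = k \<and> (\<forall>x\<in>K. \<forall>y\<in>K. x \<noteq> y \<longrightarrow> adj x y)}"
  let ?ys = "filter (adj x) xs"
  have IH: "set ` set (cliques adj k ?ys) = ?R k ?ys"
    "set ` set (cliques adj (Suc k) xs) = ?R (Suc k) xs"
    using 3 by simp_all
  \<comment> \<open>\<open>ins\<close> and \<open>del\<close> give the bijection between cliques
    through \<open>x\<close> and smaller cliques among the later neighbours of
    \<open>x\<close>.\<close>
  have ins: "insert x K \<in> ?R (Suc k) (x # xs)" if "K \<in> ?R k ?ys" for K
  proof -
    have "x \<notin> K" "finite K" using that 3(3) finite_subset[of K "set ?ys"] by auto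
    moreover have "adj y x" if "y \<in> K" for y
      using that \<open>K \<in> ?R k ?ys\<close> 3(4)[of x y] by auto
    ultimately show ?thesis using that by auto
  qed
  have del: "K \<in> insert x ` ?R k ?ys" if "K \<in> ?R (Suc k) (x # xs)" "x \<in> K" for K
  proof (rule image_eqI)
    show "K = insert x (K - {x})" using that by auto
    have "finite K" using that finite_subset[of K "set (x # xs)"] by auto
    then show "K - {x} \<in> ?R k ?ys" using that by auto
  qed
  have "?R (Suc k) (x # xs) = insert x ` ?R k ?ys \<union> ?R (Suc k) xs"
  proof (intro equalityI Un_least subsetI)
    fix K assume K: "K \<in> ?R (Suc k) (x # xs)"
    show "K \<in> insert x ` ?R k ?ys \<union> ?R (Suc k) xs"
    proof (cases "x \<in> K")
      case True
      then show ?thesis using del[OF K] by (intro UnI1)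
    next
      case False
      then show ?thesis using K by (intro UnI2) auto
    qed
  next
    fix K assume "K \<in> insert x ` ?R k ?ys"
    then show "K \<in> ?R (Suc k) (x # xs)" using ins by (elim imageE) simp
  qed auto
  then show ?case
    unfolding IH[symmetric] by (simp add: image_Un image_image)
qed

text \<open>Distinctness holds even for the underlying sets: the first branch yields sets containing
  \<open>x\<close>, the second sets avoiding it, and \<open>insert x\<close> is injective on sets
  avoiding \<open>x\<close>.\<close>

lemma distinct_cliques:
  "distinct xs \<Longrightarrow> distinct (map set (cliques adj k xs))"
proof (induction adj k xs rule: cliques.induct)
  case (3 adj k x xs)
  have sub: "set K \<subseteq> set ys" if "K \<in> set (cliques adj l ys)" for K l ys
    using that by (induction adj l ys arbitrary: K rule: cliques.induct) fastforce+
  have "inj_on (insert x) {K. x \<notin> K}" by (auto simp: inj_on_def)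
  then have "inj_on (insert x) (set ` set (cliques adj k (filter (adj x) xs)))"
    by (rule inj_on_subset) (use 3(3) sub in fastforce)
  then have "distinct (map (insert x) (map set (cliques adj k (filter (adj x) xs))))"
    using 3 by (simp add: distinct_map comp_inj_on)
  then have "distinct (map (\<lambda>K. insert x (set K)) (cliques adj k (filter (adj x) xs)))"
    by (simp add: o_def)
  moreover have "insert x (set K) \<noteq> set K'" if "K' \<in> set (cliques adj (Suc k) xs)" for K K'
    using sub[OF that] 3(3) by auto
  ultimately show ?case using 3 by (auto simp: o_def)
qed auto

lemma card_cliques:
  assumes "distinct xs" "\<And>x y. x \<in> set xs \<Longrightarrow> y \<in> set xs \<Longrightarrow> adj x y \<longleftrightarrow> adj y x"
  shows "card {K. K \<subseteq> set xs \<and> card K = k \<and> (\<forall>x\<in>K. \<forall>y\<in>K. x \<noteq> y \<longrightarrow> adj x y)}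
    = length (cliques adj k xs)"
proof -
  have "card (set ` set (cliques adj k xs)) = length (cliques adj k xs)"
    using distinct_card[OF distinct_cliques[OF assms(1), of adj k]] by simp
  then show ?thesis using set_cliques[of xs adj k] assms by simp
qed

subsection \<open>Indices modulo 6 and the Fourier transform\<close>

lemma UNIV_6: "(UNIV :: 6 set) = {0,1,2,3,4,5}"
proof -
  have "card {0,1,2,3,4,5::6} = 6" by simp
  then show ?thesis by (intro sym[OF card_subset_eq]) auto
qed

lemma sum_6: "(\<Sum>k\<in>(UNIV :: 6 set). f k) = f 0 + f 1 + f 2 + f 3 + f 4 + f 5"
  unfolding UNIV_6 by (simp add: add.assoc)

lemma forall_6: "(\<forall>k::6. P k) \<longleftrightarrow> P 0 \<and> P 1 \<and> P 2 \<and> P 3 \<and> P 4 \<and> P 5"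
  using UNIV_6 by (metis UNIV_I empty_iff insert_iff)

lemma of_int_6_eq_iff: "of_int m = (of_int n :: 6) \<longleftrightarrow> [m = n] (mod 6)"
proof -
  have "of_int m = (of_int n :: 6) \<longleftrightarrow> of_int (m - n) = (0 :: 6)" by simp
  also have "\<dots> \<longleftrightarrow> 6 dvd m - n" by (simp only: of_int_eq_0_iff_char_dvd) simp
  finally show ?thesis by (simp add: cong_iff_dvd_diff)
qed

definition cube_root :: complex where "cube_root = Complex (- 1 / 2) (sqrt 3 / 2)"

text \<open>The basic additive character of the integers modulo 6; every other one is
  \<open>\<lambda>k. chi6 (k * l)\<close> for some \<open>l\<close>.\<close>

definition chi6 :: "6 \<Rightarrow> complex" where "chi6 k = omega6 ^ nat (Rep_bit0 k)"

lemma omega6_eq: "omega6 = Complex (1 / 2) (sqrt 3 / 2)"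
proof -
  have "omega6 = cis (pi / 3)" unfolding omega6_def cis_conv_exp by (simp add: field_simps)
  then show ?thesis by (simp add: complex_eq_iff cos_60 sin_60)
qed

lemma omega6_powers:
  "omega6 ^ 2 = cube_root" "omega6 ^ 3 = -1" "omega6 ^ 4 = cube_root\<^sup>2" "omega6 ^ 5 = - cube_root"
  "omega6 ^ 6 = 1" "omega6 = - cube_root\<^sup>2" "cube_root ^ 3 = 1" "1 + cube_root + cube_root\<^sup>2 = 0"
  "cube_root\<^sup>2 = Complex (- 1 / 2) (- sqrt 3 / 2)"
  by (simp_all add: omega6_eq cube_root_def complex_eq_iff power2_eq_square numeral_eq_Suc field_simps)

lemma norm_cube_root [simp]: "cmod cube_root = 1"
  by (simp add: cube_root_def cmod_def power_divide)

lemma norm_omega6 [simp]: "cmod omega6 = 1"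
  by (simp add: omega6_eq cmod_def power_divide)

lemma omega6_power_mod: "omega6 ^ (n mod 6) = omega6 ^ n"
proof -
  have "omega6 ^ n = omega6 ^ (6 * (n div 6) + n mod 6)" by simp
  then show ?thesis by (simp only: power_add power_mult omega6_powers(5)) simp
qed

lemma chi6_of_nat: "chi6 (of_nat n) = omega6 ^ n"
proof -
  have "Rep_bit0 (of_nat n :: 6) = int n mod 6"
    by (simp add: bit0.of_nat_eq bit0.Rep_Abs_mod[where 'a=3, simplified])
  then show ?thesis by (simp add: chi6_def nat_mod_distrib omega6_power_mod)
qed

lemma ex_of_nat_6: "\<exists>n. k = (of_nat n :: 6)"
  by (metis bit0_cases of_nat_nat)

lemma chi6_add: "chi6 (j + k) = chi6 j * chi6 k"
  using ex_of_nat_6[of j] ex_of_nat_6[of k]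
  by (auto simp: chi6_of_nat power_add simp flip: of_nat_add)

lemma chi6_0 [simp]: "chi6 0 = 1"
  using chi6_of_nat[of 0] by simp

lemma chi6_1 [simp]: "chi6 1 = omega6"
  using chi6_of_nat[of 1] by simp

lemma chi6_numeral [simp]: "chi6 (numeral w) = omega6 ^ (numeral w mod 6)"
  unfolding omega6_power_mod using chi6_of_nat[of "numeral w"] by simp

lemma norm_chi6 [simp]: "cmod (chi6 k) = 1"
  by (simp add: chi6_def norm_power)

lemma chi6_minus: "chi6 (- k) = cnj (chi6 k)"
proof -
  have "chi6 (- k) * chi6 k = 1" by (simp flip: chi6_add)
  moreover have "cnj (chi6 k) * chi6 k = 1"
    by (simp add: complex_norm_square[symmetric] mult.commute)
  ultimately show ?thesis
    by (metis mult_cancel_right norm_chi6 norm_zero zero_neq_one)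
qed

lemma chi6_inj: "chi6 j = chi6 k \<longleftrightarrow> j = k"
proof
  assume "chi6 j = chi6 k"
  then have "chi6 (j - k) = 1"
    by (metis chi6_0 chi6_add diff_add_cancel mult_cancel_right2 norm_chi6 norm_zero zero_neq_one)
  moreover have "\<forall>i::6. chi6 i = 1 \<longrightarrow> i = 0"
    unfolding forall_6
    by (simp add: omega6_powers(1-5,9)) (simp add: omega6_eq cube_root_def complex_eq_iff)
  ultimately show "j = k" by (metis diff_0_right eq_iff_diff_eq_0)
qed auto

section \<open>Biunimodular vectors and the splitting of the Fourier transform\<close>

definition fourier6 :: "complex ^ 6 \<Rightarrow> 6 \<Rightarrow> complex"
  where "fourier6 x l = (\<Sum>k\<in>UNIV. chi6 (k * l) * x $ k)"

text \<open>The transform is not normalised: modulus 1 here corresponds to modulus 1 / sqrt 6 under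
  the unitary Fourier transform.\<close>

definition biunimodular :: "complex ^ 6 \<Rightarrow> bool"
  where "biunimodular x \<longleftrightarrow> (\<forall>k. (cmod (x $ k))\<^sup>2 = 1 / 6) \<and> (\<forall>l. (cmod (fourier6 x l))\<^sup>2 = 1)"

text \<open>A spectrum is flat iff the cyclic autocorrelation vanishes off zero. The three squared
  moduli are \<open>E\<close> plus twice the real parts of \<open>G\<close> times the cube roots of
  unity; they average to \<open>E\<close>, and all three real parts vanish only for
  \<open>G = 0\<close>.\<close>

lemma dft3_flat_iff:
  "((cmod (p0 + p1 + p2))\<^sup>2 = 6 \<and> (cmod (p0 + cube_root * p1 + cube_root\<^sup>2 * p2))\<^sup>2 = 6
      \<and> (cmod (p0 + cube_root\<^sup>2 * p1 + cube_root * p2))\<^sup>2 = 6) \<longleftrightarrow>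
   (cmod p0)\<^sup>2 + (cmod p1)\<^sup>2 + (cmod p2)\<^sup>2 = 6 \<and> p1 * cnj p0 + p2 * cnj p1 + p0 * cnj p2 = 0"
proof -
  define E where "E = (cmod p0)\<^sup>2 + (cmod p1)\<^sup>2 + (cmod p2)\<^sup>2"
  define G where "G = p1 * cnj p0 + p2 * cnj p1 + p0 * cnj p2"
  have expand: "(cmod (a + b + c))\<^sup>2 = (cmod a)\<^sup>2 + (cmod b)\<^sup>2 + (cmod c)\<^sup>2
      + 2 * Re (b * cnj a + c * cnj b + a * cnj c)" for a b c
    unfolding cmod_power2 by (simp add: power2_eq_square algebra_simps)
  define v where "v = cube_root\<^sup>2"
  have cw: "cnj cube_root = v" "cnj v = cube_root" "v * v = cube_root" "cube_root * cube_root = v"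
    unfolding v_def omega6_powers(9) by (simp_all add: cube_root_def complex_eq_iff power2_eq_square)
  have cw': "v * (v * x) = cube_root * x" "cube_root * (cube_root * x) = v * x" for x
    by (simp_all add: cw flip: mult.assoc)
  \<comment> \<open>Twisting the entries by powers of a cube root of unity multiplies the
    autocorrelation \<open>G\<close> by a cube root of unity.\<close>
  have "cube_root * p1 * cnj p0 + v * p2 * cnj (cube_root * p1) + p0 * cnj (v * p2) = cube_root * G"
    and "v * p1 * cnj p0 + cube_root * p2 * cnj (v * p1) + p0 * cnj (cube_root * p2) = v * G"
    unfolding G_def by (simp_all add: cw cw' algebra_simps)
  then have *: "(cmod (p0 + p1 + p2))\<^sup>2 = E + 2 * Re G"
    "(cmod (p0 + cube_root * p1 + cube_root\<^sup>2 * p2))\<^sup>2 = E - Re G - sqrt 3 * Im G"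
    "(cmod (p0 + cube_root\<^sup>2 * p1 + cube_root * p2))\<^sup>2 = E - Re G + sqrt 3 * Im G"
    unfolding expand v_def[symmetric]
    by (simp_all add: G_def[symmetric] E_def norm_mult norm_power v_def)
      (simp_all add: omega6_powers(9), simp_all add: cube_root_def)
  have "G = 0 \<longleftrightarrow> Re G = 0 \<and> Im G = 0" by (simp add: complex_eq_iff)
  \<comment> \<open>Absorbing \<open>sqrt 3\<close> makes all equations linear in \<open>E\<close>,
    \<open>Re G\<close> and \<open>sqrt 3 * Im G\<close>.\<close>
  moreover have "Im G = 0 \<longleftrightarrow> sqrt 3 * Im G = 0" by simp
  ultimately show ?thesis
    unfolding * E_def[symmetric] G_def[symmetric] by argo
qed

text \<open>The Chinese remainder theorem splits an index modulo 6 into its residues modulo 2 and 3.\<close>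

definition torus :: "(nat \<Rightarrow> complex) \<Rightarrow> (nat \<Rightarrow> complex) \<Rightarrow> complex ^ 6"
  where "torus y z = (\<chi> j. let n = nat (Rep_bit0 j) in
    complex_of_real (1 / sqrt 6) * (y (n mod 3) * (if even n then z (n mod 3) else cnj (z (n mod 3)))))"

lemma torus_nth:
  "torus y z $ 0 = complex_of_real (1 / sqrt 6) * (y 0 * z 0)"
  "torus y z $ 1 = complex_of_real (1 / sqrt 6) * (y 1 * cnj (z 1))"
  "torus y z $ 2 = complex_of_real (1 / sqrt 6) * (y 2 * z 2)"
  "torus y z $ 3 = complex_of_real (1 / sqrt 6) * (y 0 * cnj (z 0))"
  "torus y z $ 4 = complex_of_real (1 / sqrt 6) * (y 1 * z 1)"
  "torus y z $ 5 = complex_of_real (1 / sqrt 6) * (y 2 * cnj (z 2))"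
  by (simp_all add: torus_def Let_def bit0.Rep_numeral bit0.Rep_0 bit0.Rep_1)

text \<open>The two coordinates with the same residue modulo 3 contribute complex conjugate
  multiples of \<open>cnj (y s) * y' s\<close>, which add up to twice a real part.\<close>

lemma braket_torus:
  "braket (torus y z) (torus y' z') =
    (1 / 3) * (\<Sum>s<3. cnj (y s) * y' s * complex_of_real (Re (cnj (z s) * z' s)))"
proof -
  have s6: "complex_of_real (sqrt 6) * complex_of_real (sqrt 6) = 6"
    by (metis of_real_mult of_real_numeral real_sqrt_mult_self abs_numeral)
  have r: "complex_of_real (Re (cnj a * b)) = (cnj a * b + a * cnj b) / 2" for a b
    by (simp add: complex_eq_iff)
  show ?thesis
    unfolding braket_def sum_6 torus_nth r
    by (simp add: numeral_3_eq_3 numeral_2_eq_2 field_simps s6)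
qed

text \<open>For unimodular \<open>y\<close> this says that the vector with entries
  \<open>2 * y s * c s\<close> has a flat three-point Fourier transform of modulus sqrt 6; hence 3/2
  = 6/4.\<close>

definition balanced :: "(nat \<Rightarrow> complex) \<Rightarrow> (nat \<Rightarrow> real) \<Rightarrow> bool"
  where "balanced y c \<longleftrightarrow> (c 0)\<^sup>2 + (c 1)\<^sup>2 + (c 2)\<^sup>2 = 3 / 2 \<and>
    complex_of_real (c 0 * c 1) * (y 1 * cnj (y 0)) + complex_of_real (c 1 * c 2) * (y 2 * cnj (y 1))
      + complex_of_real (c 2 * c 0) * (y 0 * cnj (y 2)) = 0"

lemma balanced_iff_dft3:
  assumes "\<And>s. s < 3 \<Longrightarrow> cmod (y s) = 1"
  shows "balanced y c \<longleftrightarrow>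
    (let p = (\<lambda>s. 2 * y s * complex_of_real (c s)) in
      (cmod (p 0 + p 1 + p 2))\<^sup>2 = 6 \<and> (cmod (p 0 + cube_root * p 1 + cube_root\<^sup>2 * p 2))\<^sup>2 = 6
      \<and> (cmod (p 0 + cube_root\<^sup>2 * p 1 + cube_root * p 2))\<^sup>2 = 6)"
proof -
  define p where "p = (\<lambda>s. 2 * y s * complex_of_real (c s))"
  have "(cmod (p s))\<^sup>2 = 4 * (c s)\<^sup>2" if "s < 3" for s
    using assms[OF that] by (simp add: p_def norm_mult power_mult_distrib)
  from this[of 0] this[of 1] this[of 2] have sq: "(cmod (p 0))\<^sup>2 + (cmod (p 1))\<^sup>2 + (cmod (p 2))\<^sup>2 = 6 \<longleftrightarrow>
      (c 0)\<^sup>2 + (c 1)\<^sup>2 + (c 2)\<^sup>2 = 3 / 2"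
    by auto
  have cross: "p 1 * cnj (p 0) + p 2 * cnj (p 1) + p 0 * cnj (p 2) =
      4 * (complex_of_real (c 0 * c 1) * (y 1 * cnj (y 0)) + complex_of_real (c 1 * c 2) * (y 2 * cnj (y 1))
      + complex_of_real (c 2 * c 0) * (y 0 * cnj (y 2)))"
    by (simp add: p_def algebra_simps)
  show ?thesis
    unfolding balanced_def p_def[symmetric] Let_def dft3_flat_iff sq cross
    by (simp only: mult_eq_0_iff) simp
qed

text \<open>Shifting the index by 3 multiplies the character of frequency \<open>l\<close> by the
  sign (-1)^l. So even frequencies see only the sums \<open>2 * y s * Re (z s)\<close> of the paired
  coordinates, odd ones only the differences \<open>2 * \<i> * y s * Im (z s)\<close>, and the
  six-point transform splits into two three-point ones.\<close>

lemma biunimodular_torus_iff: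
  assumes y: "\<And>s. s < 3 \<Longrightarrow> cmod (y s) = 1" and z: "\<And>s. s < 3 \<Longrightarrow> cmod (z s) = 1"
  shows "biunimodular (torus y z) \<longleftrightarrow> balanced y (\<lambda>s. Re (z s)) \<and> balanced y (\<lambda>s. Im (z s))"
proof -
  define p where "p = (\<lambda>s. 2 * y s * complex_of_real (Re (z s)))"
  define m where "m = (\<lambda>s. 2 * y s * complex_of_real (Im (z s)))"
  have pm: "y s * z s = (p s + \<i> * m s) / 2" "y s * cnj (z s) = (p s - \<i> * m s) / 2" for s
    by (simp_all add: p_def m_def complex_eq_iff algebra_simps)
  let ?r = "complex_of_real (1 / sqrt 6)"
  have F: "fourier6 (torus y z) 0 = ?r * (p 0 + p 1 + p 2)"
    "fourier6 (torus y z) 2 = ?r * (p 0 + cube_root * p 1 + cube_root\<^sup>2 * p 2)"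
    "fourier6 (torus y z) 4 = ?r * (p 0 + cube_root\<^sup>2 * p 1 + cube_root * p 2)"
    "fourier6 (torus y z) 3 = ?r * (\<i> * (m 0 + m 1 + m 2))"
    "fourier6 (torus y z) 5 = ?r * (\<i> * (m 0 + cube_root * m 1 + cube_root\<^sup>2 * m 2))"
    "fourier6 (torus y z) 1 = ?r * (\<i> * (m 0 + cube_root\<^sup>2 * m 1 + cube_root * m 2))"
    unfolding fourier6_def sum_6 torus_nth pm
    by (simp_all add: omega6_powers(1-4)) (simp_all add: omega6_powers(6) field_simps)
  have n: "(cmod (?r * x))\<^sup>2 = 1 \<longleftrightarrow> (cmod x)\<^sup>2 = 6" for x
    by (simp add: norm_mult norm_divide power_mult_distrib power_divide)
  have ni: "cmod (\<i> * x) = cmod x" for x by (simp add: norm_mult)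
  have "(cmod (torus y z $ k))\<^sup>2 = 1 / 6" for k
    using y[of "nat (Rep_bit0 k) mod 3"] z[of "nat (Rep_bit0 k) mod 3"]
    by (simp add: torus_def Let_def norm_mult norm_divide power_mult_distrib power_divide)
  then have "biunimodular (torus y z) \<longleftrightarrow> (\<forall>l. (cmod (fourier6 (torus y z) l))\<^sup>2 = 1)"
    unfolding biunimodular_def by simp
  moreover have "balanced y (\<lambda>s. Re (z s)) \<longleftrightarrow> (cmod (p 0 + p 1 + p 2))\<^sup>2 = 6
      \<and> (cmod (p 0 + cube_root * p 1 + cube_root\<^sup>2 * p 2))\<^sup>2 = 6
      \<and> (cmod (p 0 + cube_root\<^sup>2 * p 1 + cube_root * p 2))\<^sup>2 = 6"
    unfolding p_def by (subst balanced_iff_dft3[OF y]) (simp_all only: Let_def)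
  moreover have "balanced y (\<lambda>s. Im (z s)) \<longleftrightarrow> (cmod (m 0 + m 1 + m 2))\<^sup>2 = 6
      \<and> (cmod (m 0 + cube_root * m 1 + cube_root\<^sup>2 * m 2))\<^sup>2 = 6
      \<and> (cmod (m 0 + cube_root\<^sup>2 * m 1 + cube_root * m 2))\<^sup>2 = 6"
    unfolding m_def by (subst balanced_iff_dft3[OF y]) (simp_all only: Let_def)
  ultimately show ?thesis
    unfolding forall_6 F n ni by blast
qed

subsection \<open>The vectors described by the codes\<close>

definition beta :: real where "beta = sqrt (sqrt 3 / 2)"

text \<open>The root of x^2 - (sqrt 3 - 1) x + 1 in the upper half plane. Together with 1, it and
  its conjugate are the roots of x^3 - sqrt 3 x^2 + sqrt 3 x - 1. Up to sign and conjugation it is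
  Bjorck's constant for cyclic 6-roots.\<close>

definition bjorck :: complex where "bjorck = Complex ((sqrt 3 - 1) / 2) beta"

text \<open>Stands for the power of \<open>bjorck\<close> with exponent 0, 1 or -1; all other
  integers fall under the last branch.\<close>

definition bjorck_root :: "int \<Rightarrow> complex"
  where "bjorck_root m = (if m = 0 then 1 else if m = 1 then bjorck else cnj bjorck)"

definition zeta8 :: "bool \<Rightarrow> complex"
  where "zeta8 q = Complex (1 / sqrt 2) (if q then 1 / sqrt 2 else - 1 / sqrt 2)"

definition code_vec :: "code \<Rightarrow> complex ^ 6"
  where "code_vec c = torus (\<lambda>s. cube_root ^ nat (fst (snd c ! s)))
    (\<lambda>s. zeta8 (fst c) * bjorck_root (snd (snd c ! s)))"

lemma beta_pos: "beta > 0" and beta_sq: "beta * beta = sqrt 3 / 2"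
  by (simp_all add: beta_def)

lemma norm_bjorck: "cmod bjorck = 1"
proof -
  have "(cmod bjorck)\<^sup>2 = 1"
    unfolding cmod_power2 bjorck_def by (simp add: power2_eq_square beta_sq field_simps)
  then show ?thesis by (simp add: power2_eq_1_iff) (smt (verit) norm_ge_zero)
qed

lemma norm_bjorck_root [simp]: "cmod (bjorck_root m) = 1"
  by (simp add: bjorck_root_def norm_bjorck)

lemma norm_zeta8 [simp]: "cmod (zeta8 q) = 1"
  by (simp add: zeta8_def cmod_def power_divide)

text \<open>The innermost choice in \<open>codes\<close>, named so that membership in
  \<open>codes\<close> becomes a finite check in both directions.\<close>

definition code_shape :: "int \<Rightarrow> int \<Rightarrow> (int \<times> int \<times> int) list"
  where "code_shape n1 n2 = (if n2 = (2 * n1) mod 3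
    then [(0,1,-1), (0,-1,1), (1,0,-1), (-1,0,1), (1,-1,0), (-1,1,0)] else [(0,0,0)])"

lemma code_intro:
  assumes "n1 \<in> {0,1,2}" "n2 \<in> {0,1,2}" "(m0, m1, m2) \<in> set (code_shape n1 n2)"
  shows "(q, [(0, m0), (n1, m1), (n2, m2)]) \<in> set codes"
proof -
  have "\<forall>q\<in>set [True,False]. \<forall>n1\<in>set [0,1,2]. \<forall>n2\<in>set [0,1,2].
      \<forall>m\<in>set (code_shape n1 n2). (q, [(0, fst m), (n1, fst (snd m)), (n2, snd (snd m))]) \<in> set codes"
    by code_simp
  from this[rule_format, of q n1 n2 "(m0, m1, m2)"] assms show ?thesis by auto
qed

fun code_form :: "code \<Rightarrow> bool" where
  "code_form (q, [(n0, m0), (n1, m1), (n2, m2)]) \<longleftrightarrow>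
    n0 = 0 \<and> n1 \<in> {0,1,2} \<and> n2 \<in> {0,1,2} \<and> m0 \<in> {0,1,-1} \<and> m1 \<in> {0,1,-1}
      \<and> m2 \<in> {0,1,-1} \<and> (m0, m1, m2) \<in> set (code_shape n1 n2)"
| "code_form _ \<longleftrightarrow> False"

lemma code_cases:
  assumes "c \<in> set codes"
  obtains q m0 n1 m1 n2 m2 where "c = (q, [(0, m0), (n1, m1), (n2, m2)])"
    "n1 \<in> {0,1,2}" "n2 \<in> {0,1,2}" "m0 \<in> {0,1,-1}" "m1 \<in> {0,1,-1}" "m2 \<in> {0,1,-1}"
    "(m0, m1, m2) \<in> set (code_shape n1 n2)"
proof -
  have "\<forall>c\<in>set codes. code_form c" by code_simp
  then have "code_form c" using assms by blast
  then show ?thesis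
  proof (cases rule: code_form.elims(2))
    case (1 q n0 m0 n1 m1 n2 m2)
    then show ?thesis using that by (simp only: code_form.simps)
  qed
qed

lemma balanced_cong:
  assumes "\<And>s. s < 3 \<Longrightarrow> y s = y' s" "\<And>s. s < 3 \<Longrightarrow> c s = c' s"
  shows "balanced y c = balanced y' c'"
  using assms by (simp add: balanced_def)

lemma balanced_const_iff:
  assumes "t * t = 1 / 2"
  shows "balanced y (\<lambda>_. t) \<longleftrightarrow> y 1 * cnj (y 0) + y 2 * cnj (y 1) + y 0 * cnj (y 2) = 0"
proof -
  have "t\<^sup>2 + t\<^sup>2 + t\<^sup>2 = 3 / 2" using assms by (simp add: power2_eq_square)
  then show ?thesis
    unfolding balanced_def assms by (simp only: mult_eq_0_iff flip: distrib_left) simp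
qed

lemma biunimodular_code_vec:
  assumes "c \<in> set codes"
  shows "biunimodular (code_vec c)"
  using assms
proof (cases rule: code_cases)
  case (1 q m0 n1 m1 n2 m2)
  define y where "y = (\<lambda>s. cube_root ^ nat (fst (snd c ! s)))"
  define z where "z = (\<lambda>s. zeta8 (fst c) * bjorck_root (snd (snd c ! s)))"
  have ys: "y 0 = 1" "y 1 = cube_root ^ nat n1" "y 2 = cube_root ^ nat n2"
    by (simp_all add: y_def 1)
  have zs: "z 0 = zeta8 q * bjorck_root m0" "z 1 = zeta8 q * bjorck_root m1" "z 2 = zeta8 q * bjorck_root m2"
    by (simp_all add: z_def 1)
  have n: "n1 = 0 \<or> n1 = 1 \<or> n1 = 2" "n2 = 0 \<or> n2 = 1 \<or> n2 = 2" using 1 by auto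
  \<comment> \<open>The flag \<open>b\<close> treats the conditions on real and imaginary parts at
    once.\<close>
  define f where "f b x = (if b then Re x else Im x)" for b x
  have bal: "balanced y (\<lambda>s. f b (z s))" for b
  proof (cases "n2 = (2 * n1) mod 3")
    case False
    then have m: "m0 = 0" "m1 = 0" "m2 = 0" using 1(7) by (auto simp: code_shape_def)
    have "balanced y (\<lambda>s. f b (zeta8 q)) \<longleftrightarrow>
        y 1 * cnj (y 0) + y 2 * cnj (y 1) + y 0 * cnj (y 2) = 0"
      by (rule balanced_const_iff) (simp add: f_def zeta8_def)
    \<comment> \<open>Away from arithmetic progressions the three ratios are the three different
      cube roots of unity.\<close>
    also have "\<dots>"
      using n False unfolding ys
      by (elim disjE) (simp_all add: omega6_powers(9) cube_root_def complex_eq_iff power2_eq_square)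
    finally show ?thesis
      by (subst balanced_cong[where y' = y and c' = "\<lambda>s. f b (zeta8 q)"])
        (auto simp: less_Suc_eq numeral_3_eq_3 z_def 1 m bjorck_root_def)
  next
    case True
    define x where "x m = f b (zeta8 q * bjorck_root m)" for m
    have x: "x 0 = (if b \<or> q then 1 else -1) / sqrt 2"
      "x 1 = (if b \<or> q then 1 else -1) * ((sqrt 3 - 1) / 2 + (if b = q then -1 else 1) * beta) / sqrt 2"
      "x (-1) = (if b \<or> q then 1 else -1) * ((sqrt 3 - 1) / 2 - (if b = q then -1 else 1) * beta) / sqrt 2"
      by (cases b; cases q; simp add: x_def f_def zeta8_def bjorck_root_def bjorck_def field_simps)+
    have sq: "(x 0)\<^sup>2 + (x 1)\<^sup>2 + (x (-1))\<^sup>2 = 3 / 2"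
      unfolding x by (cases b; cases q) (simp_all add: power2_eq_square field_simps beta_sq)
    have pr: "x 0 * x 1 + x 1 * x (-1) + x (-1) * x 0 = 0"
      unfolding x by (cases b; cases q) (simp_all add: power2_eq_square field_simps beta_sq)
    have zx: "f b (z 0) = x m0" "f b (z 1) = x m1" "f b (z 2) = x m2"
      by (simp_all only: x_def zs)
    have m: "(x m0)\<^sup>2 + (x m1)\<^sup>2 + (x m2)\<^sup>2 = 3 / 2" "x m0 * x m1 + x m1 * x m2 + x m2 * x m0 = 0"
      using 1(7) True sq pr by (auto simp: code_shape_def algebra_simps)
    \<comment> \<open>An arithmetic progression of exponents makes the three cyclic ratios equal, so
      the condition on the products loses its complex weights.\<close>
    obtain u where u: "y 1 * cnj (y 0) = u" "y 2 * cnj (y 1) = u" "y 0 * cnj (y 2) = u"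
    proof
      show "y 1 * cnj (y 0) = y 1" "y 2 * cnj (y 1) = y 1" "y 0 * cnj (y 2) = y 1"
        using n True unfolding ys
        by (elim disjE; simp add: omega6_powers(9); simp add: cube_root_def complex_eq_iff power2_eq_square)+
    qed
    have "complex_of_real (x m0 * x m1) * u + complex_of_real (x m1 * x m2) * u + complex_of_real (x m2 * x m0) * u
        = complex_of_real (x m0 * x m1 + x m1 * x m2 + x m2 * x m0) * u"
      by (simp add: algebra_simps)
    then show ?thesis unfolding balanced_def zx u m by simp
  qed
  have "code_vec c = torus y z" by (simp add: code_vec_def y_def z_def)
  then show ?thesis
    using bal[of True] bal[of False]
    by (simp add: biunimodular_torus_iff y_def z_def norm_mult norm_power f_def)
qed

subsection \<open>Solving the biunimodularity equations\<close>

lemma torus_cong: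
  assumes "\<And>s. s < 3 \<Longrightarrow> y s * z s = k * (y' s * z' s)"
    and "\<And>s. s < 3 \<Longrightarrow> y s * cnj (z s) = k * (y' s * cnj (z' s))"
  shows "torus y z = k *s torus y' z'"
  using assms by (simp add: torus_def vec_eq_iff Let_def)

lemma torus_eq_code_vec:
  assumes "y 0 = k" "y 1 = k * cube_root ^ nat n1" "y 2 = k * cube_root ^ nat n2"
    and "z 0 = zeta8 q * bjorck_root m0" "z 1 = zeta8 q * bjorck_root m1" "z 2 = zeta8 q * bjorck_root m2"
  shows "torus y z = k *s code_vec (q, [(0, m0), (n1, m1), (n2, m2)])"
proof -
  have "s = 0 \<or> s = 1 \<or> s = 2" if "s < 3" for s :: nat using that by auto
  then show ?thesis
    unfolding code_vec_def by (intro torus_cong) (use assms in fastforce)+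
qed

section \<open>The two special cases: constant \<open>z\<close>, and equal ratios of consecutive
  \<open>y\<close>\<close>

lemma cube_root_mult:
  "cube_root * cube_root = cube_root\<^sup>2" "cube_root * cube_root\<^sup>2 = 1" "cube_root\<^sup>2 * cube_root = 1"
  "cube_root\<^sup>2 * cube_root\<^sup>2 = cube_root" "cube_root ^ 4 = cube_root"
  unfolding power4_eq_xxxx by (simp_all add: omega6_powers(9)) (simp_all add: cube_root_def complex_eq_iff power2_eq_square)

lemma cube_root_unity:
  assumes "x ^ 3 = 1"
  obtains n :: int where "n \<in> {0,1,2}" "x = cube_root ^ nat n"
proof -
  have cw: "cube_root + cube_root\<^sup>2 = -1"
    using omega6_powers(8) by (simp add: add_eq_0_iff add.assoc)
  have "(x - 1) * (x - cube_root) * (x - cube_root\<^sup>2) =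
      (x - 1) * (x\<^sup>2 - (cube_root + cube_root\<^sup>2) * x + cube_root * cube_root\<^sup>2)"
    by (simp add: algebra_simps power2_eq_square)
  also have "\<dots> = x ^ 3 - 1"
    unfolding cw cube_root_mult by (simp add: algebra_simps power2_eq_square power3_eq_cube)
  finally have "x = 1 \<or> x = cube_root \<or> x = cube_root\<^sup>2" using assms by auto
  then show ?thesis using that[of 0] that[of 1] that[of 2] by auto
qed

lemma cnj_eq_inverse: "cmod x = 1 \<Longrightarrow> cnj x = inverse x"
  by (metis complex_cnj_cnj complex_cnj_zero complex_norm_square inverse_unique mult_1
      of_real_1 one_power2 power2_eq_square)

text \<open>Conjugation inverts unimodular numbers, so the second elementary symmetric function
  vanishes along with the first, and all three are roots of x^3 = 1. If two agreed, the third would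
  have modulus 2.\<close>

lemma vanishing_unimodular_sum:
  assumes "cmod u0 = 1" "cmod u1 = 1" "cmod u2 = 1" "u0 + u1 + u2 = 0" "u0 * u1 * u2 = 1"
  shows "u0 ^ 3 = 1" "u1 ^ 3 = 1" "u0 \<noteq> u1"
proof -
  have nz: "u0 \<noteq> 0" "u1 \<noteq> 0" "u2 \<noteq> 0" using assms by auto
  have "cnj u0 + cnj u1 + cnj u2 = 0" using assms(4) by (metis complex_cnj_add complex_cnj_zero)
  then have "inverse u0 + inverse u1 + inverse u2 = 0"
    unfolding assms(1-3)[THEN cnj_eq_inverse] .
  then have e2: "u0 * u1 + u1 * u2 + u2 * u0 = 0" using nz by (simp add: field_simps)
  have "u0 ^ 3 = u0 * u1 * u2 + u0 * (u0 * (u0 + u1 + u2) - (u0 * u1 + u1 * u2 + u2 * u0))"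
    by (simp add: algebra_simps power3_eq_cube)
  then show "u0 ^ 3 = 1" unfolding e2 using assms by simp
  have "u1 ^ 3 = u0 * u1 * u2 + u1 * (u1 * (u0 + u1 + u2) - (u0 * u1 + u1 * u2 + u2 * u0))"
    by (simp add: algebra_simps power3_eq_cube)
  then show "u1 ^ 3 = 1" unfolding e2 using assms by simp
  show "u0 \<noteq> u1"
  proof
    assume "u0 = u1"
    then have "u2 = - (2 * u0)" using assms by (simp add: add_eq_0_iff algebra_simps)
    then show False using assms by (simp add: norm_mult)
  qed
qed

text \<open>For constant \<open>z\<close> the balance condition says that the three ratios sum to
  zero; their product is 1, so they are cube roots of unity.\<close>

lemma classify_gaussian:
  assumes y: "\<And>s. s < 3 \<Longrightarrow> cmod (y s) = 1"
    and z: "\<And>s. s < 3 \<Longrightarrow> z s = zeta8 q"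
    and bal: "balanced y (\<lambda>s. Re (z s))"
  shows "\<exists>c\<in>set codes. torus y z = y 0 *s code_vec c"
proof -
  have y012: "cmod (y 0) = 1" "cmod (y 1) = 1" "cmod (y 2) = 1" using y by auto
  define u0 u1 u2 where "u0 = y 1 * cnj (y 0)" and "u1 = y 2 * cnj (y 1)" and "u2 = y 0 * cnj (y 2)"
  have nz: "y 0 \<noteq> 0" "y 1 \<noteq> 0" "y 2 \<noteq> 0" using y012 by auto
  have y1: "y 1 = y 0 * u0" and y2: "y 2 = y 0 * (u0 * u1)" and prod: "u0 * u1 * u2 = 1"
    unfolding u0_def u1_def u2_def using nz y012 by (simp_all add: cnj_eq_inverse field_simps)
  have "balanced y (\<lambda>_. Re (zeta8 q))"
    using bal balanced_cong[of y y "\<lambda>s. Re (z s)" "\<lambda>_. Re (zeta8 q)"] z by simp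
  then have "u0 + u1 + u2 = 0"
    unfolding u0_def u1_def u2_def by (subst (asm) balanced_const_iff) (simp_all add: zeta8_def)
  moreover have "cmod u0 = 1" "cmod u1 = 1" "cmod u2 = 1"
    unfolding u0_def u1_def u2_def using y012 by (simp_all add: norm_mult)
  ultimately have u: "u0 ^ 3 = 1" "u1 ^ 3 = 1" "u0 \<noteq> u1"
    using prod vanishing_unimodular_sum by blast+
  obtain i where i: "i \<in> {0,1,2}" "u0 = cube_root ^ nat i" using u(1) by (rule cube_root_unity)
  obtain j where j: "j \<in> {0,1,2}" "u1 = cube_root ^ nat j" using u(2) by (rule cube_root_unity)
  have "i \<noteq> j" using u i j by auto
  \<comment> \<open>The exponents of \<open>y 1\<close> and \<open>y 2\<close> relative to
    \<open>y 0\<close> are \<open>i\<close> and \<open>i + j\<close>; since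
    \<open>i \<noteq> j\<close>, they do not continue 0 to an arithmetic progression.\<close>
  define c where "c = (q, [(0::int, 0::int), (i, 0), ((i + j) mod 3, 0)])"
  have "c \<in> set codes"
    unfolding c_def by (rule code_intro) (use i j \<open>i \<noteq> j\<close> in \<open>auto simp: code_shape_def\<close>)
  moreover have "u0 * u1 = cube_root ^ nat ((i + j) mod 3)"
    using i j by (auto simp: cube_root_mult)
  then have "torus y z = y 0 *s code_vec c"
    unfolding c_def using z y1 y2 i by (intro torus_eq_code_vec) (simp_all add: bjorck_root_def)
  ultimately show ?thesis by blast
qed

text \<open>The sum of the three numbers determines their cubic up to the unimodular product
  \<open>P\<close>; reality of the second symmetric function leaves only the signs
  \<open>P = 1\<close> and \<open>P = -1\<close>, and the second is impossible.\<close>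

lemma unimodular_triple:
  assumes v: "\<And>s. s < (3::nat) \<Longrightarrow> cmod (v s) = 1"
    and e1: "v 0 + v 1 + v 2 = complex_of_real (sqrt 3)"
    and e2: "Im (v 0 * v 1 + v 1 * v 2 + v 2 * v 0) = 0"
  obtains m0 m1 m2 where
    "(m0, m1, m2) \<in> {(0,1,-1), (0,-1,1), (1,0,-1), (-1,0,1), (1,-1,0), (-1,1,0::int)}"
    "v 0 = bjorck_root m0" "v 1 = bjorck_root m1" "v 2 = bjorck_root m2"
proof -
  define P where "P = v 0 * v 1 * v 2"
  define r where "r = complex_of_real (sqrt 3)"
  have rr: "r * r = 3" unfolding r_def by (metis of_real_mult of_real_numeral real_sqrt_mult_self abs_numeral)
  have v012: "cmod (v 0) = 1" "cmod (v 1) = 1" "cmod (v 2) = 1" using v by auto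
  then have nz: "v 0 \<noteq> 0" "v 1 \<noteq> 0" "v 2 \<noteq> 0" by auto
  \<comment> \<open>Conjugating the real sum turns it into the sum of inverses, which is the second
    symmetric function divided by \<open>P\<close>.\<close>
  have "r = cnj (v 0 + v 1 + v 2)" using e1 by (simp add: r_def)
  then have "P * r = v 0 * v 1 + v 1 * v 2 + v 2 * v 0"
    unfolding P_def using nz v012 by (simp add: cnj_eq_inverse field_simps)
  then have Pr: "v 0 * v 1 + v 1 * v 2 + v 2 * v 0 = P * r" ..
  then have "Im P = 0" using e2 by (simp add: r_def)
  moreover have "cmod P = 1" unfolding P_def using v012 by (simp add: norm_mult)
  ultimately have P1: "P = 1 \<or> P = -1" by (auto simp: complex_eq_iff cmod_def abs_if split: if_splits)
  have cubic: "(v s) ^ 3 - r * (v s)\<^sup>2 + r * P * v s - P = 0" if "s < 3" for s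
  proof -
    have "(x - v 0) * (x - v 1) * (x - v 2) = x ^ 3 - (v 0 + v 1 + v 2) * x\<^sup>2
        + (v 0 * v 1 + v 1 * v 2 + v 2 * v 0) * x - v 0 * v 1 * v 2" for x
      by (simp add: algebra_simps power2_eq_square power3_eq_cube)
    from this[of "v s"] show ?thesis
      unfolding Pr e1 using that
      by (auto simp: less_Suc_eq numeral_3_eq_3 numeral_2_eq_2 r_def P_def algebra_simps)
  qed
  \<comment> \<open>For unimodular \<open>x\<close>, dividing the quadratic by \<open>x\<close>
    gives \<open>x + cnj x = t\<close>.\<close>
  have Re_root: "2 * Re x = t" if "cmod x = 1" "x\<^sup>2 - complex_of_real t * x + 1 = 0" for x t
  proof -
    have "x \<noteq> 0" using that by auto
    have "x + cnj x = complex_of_real t"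
      using that \<open>x \<noteq> 0\<close> by (simp add: cnj_eq_inverse field_simps power2_eq_square)
    then show ?thesis by (simp add: complex_eq_iff)
  qed
  \<comment> \<open>For \<open>P = -1\<close> the cubic is (x + 1) (x^2 - (sqrt 3 + 1) x + 1).
    Unimodular roots of the second factor would have real part (sqrt 3 + 1) / 2 > 1, so all three
    numbers would be -1 and their sum -3.\<close>
  have "P = 1"
  proof (rule ccontr)
    assume "P \<noteq> 1"
    then have P: "P = -1" using P1 by simp
    have "v s = -1" if s: "s < 3" for s
    proof (rule ccontr)
      assume "v s \<noteq> -1"
      moreover have "(v s + 1) * ((v s)\<^sup>2 - (r + 1) * v s + 1) = 0"
        using cubic[OF s] by (simp add: P algebra_simps power2_eq_square power3_eq_cube)
      ultimately have "(v s)\<^sup>2 - (r + 1) * v s + 1 = 0" by (simp add: add_eq_0_iff2)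
      then have "2 * Re (v s) = sqrt 3 + 1"
        using Re_root[OF v[OF s], of "sqrt 3 + 1"] by (simp add: r_def)
      moreover have "Re (v s) \<le> 1" using complex_Re_le_cmod[of "v s"] v[OF s] by simp
      moreover have "sqrt 3 > 1" by simp
      ultimately show False by linarith
    qed
    then have "complex_of_real (sqrt 3) = -3" using e1 by simp
    then show False by (simp add: complex_eq_iff) (smt (verit) real_sqrt_ge_zero)
  qed
  have ex: "\<exists>m\<in>{0,1,-1}. v s = bjorck_root m" if s: "s < 3" for s
  proof (cases "v s = 1")
    case True
    then show ?thesis by (auto simp: bjorck_root_def)
  next
    case False
    moreover have "(v s - 1) * ((v s)\<^sup>2 - (r - 1) * v s + 1) = 0"
      using cubic[OF s] by (simp add: \<open>P = 1\<close> algebra_simps power2_eq_square power3_eq_cube)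
    ultimately have "(v s)\<^sup>2 - (r - 1) * v s + 1 = 0" by simp
    then have re: "Re (v s) = (sqrt 3 - 1) / 2"
      using Re_root[OF v[OF s], of "sqrt 3 - 1"] by (simp add: r_def)
    have "(Re (v s))\<^sup>2 + (Im (v s))\<^sup>2 = 1" using v[OF s] by (metis cmod_power2 one_power2)
    then have "Im (v s) * Im (v s) = beta * beta"
      unfolding re beta_sq by (simp add: power2_eq_square field_simps)
    then have "Im (v s) = beta \<or> Im (v s) = - beta" by (simp add: square_eq_iff)
    then have "v s = bjorck \<or> v s = cnj bjorck" using re by (auto simp: complex_eq_iff bjorck_def)
    then show ?thesis by (auto simp: bjorck_root_def)
  qed
  obtain m0 where m0: "m0 \<in> {0,1,-1}" "v 0 = bjorck_root m0" using ex[of 0] by auto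
  obtain m1 where m1: "m1 \<in> {0,1,-1}" "v 1 = bjorck_root m1" using ex[of 1] by auto
  obtain m2 where m2: "m2 \<in> {0,1,-1}" "v 2 = bjorck_root m2" using ex[of 2] by auto
  have b: "beta > 0" by (rule beta_pos)
  define t where "t = sqrt 3"
  have s3: "sqrt 3 > 1.7" "sqrt 3 < 1.8"
    by (rule real_less_rsqrt real_less_lsqrt; simp add: power2_eq_square)+
  have "Re (bjorck_root m0 + bjorck_root m1 + bjorck_root m2) = sqrt 3"
    "Im (bjorck_root m0 + bjorck_root m1 + bjorck_root m2) = 0"
    using e1 unfolding m0 m1 m2 by simp_all
  then have
    "(if m0 = 0 then 1 else (t - 1) / 2) + (if m1 = 0 then 1 else (t - 1) / 2) + (if m2 = 0 then 1 else (t - 1) / 2) = t"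
    "(if m0 = 0 then 0 else if m0 = 1 then beta else - beta) + (if m1 = 0 then 0 else if m1 = 1 then beta else - beta)
      + (if m2 = 0 then 0 else if m2 = 1 then beta else - beta) = 0"
    unfolding t_def bjorck_root_def bjorck_def by (simp_all add: if_distrib[of Re] if_distrib[of Im] cong: if_cong)
  \<comment> \<open>Unless exactly one exponent is 0, the real parts would force
    \<open>t = 3\<close>, against the bounds on sqrt 3; the imaginary parts then make the other two
    exponents opposite.\<close>
  then have "(m0, m1, m2) \<in> {(0,1,-1), (0,-1,1), (1,0,-1), (-1,0,1), (1,-1,0), (-1,1,0::int)}"
    using m0(1) m1(1) m2(1) b s3 unfolding t_def[symmetric] by (elim insertE emptyE; simp)
  then show ?thesis using that m0 m1 m2 by blast
qed

text \<open>With equal ratios, balance says that the real parts and the imaginary parts of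
  \<open>z\<close> each have vanishing second symmetric function and sum of square 3/2. So the sum
  of the \<open>z s\<close> is sqrt 3 times a primitive eighth root of unity, and \<open>pos\<close>
  selects those with positive real part.\<close>

lemma classify_linear:
  assumes y: "\<And>s. s < 3 \<Longrightarrow> cmod (y s) = 1" and z: "\<And>s. s < 3 \<Longrightarrow> cmod (z s) = 1"
    and u: "y 1 * cnj (y 0) = u" "y 2 * cnj (y 1) = u" "y 0 * cnj (y 2) = u"
    and re: "balanced y (\<lambda>s. Re (z s))" and im: "balanced y (\<lambda>s. Im (z s))"
    and pos: "Re (z 0) + Re (z 1) + Re (z 2) \<ge> 0"
  shows "\<exists>c\<in>set codes. torus y z = y 0 *s code_vec c"
proof -
  have y012: "cmod (y 0) = 1" "cmod (y 1) = 1" "cmod (y 2) = 1" using y by auto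
  have nz: "y 0 \<noteq> 0" "y 1 \<noteq> 0" "y 2 \<noteq> 0" using y012 by auto
  have shift: "a = b * u" if "cmod b = 1" "a * cnj b = u" for a b
  proof -
    have "b \<noteq> 0" using that by auto
    then show ?thesis using that by (auto simp: cnj_eq_inverse)
  qed
  have y1: "y 1 = y 0 * u" and y2: "y 2 = y 0 * u\<^sup>2"
    using shift[OF y012(1) u(1)] shift[OF y012(2) u(2)] by (simp_all add: power2_eq_square)
  have "cmod u = 1" using u y012 by (auto simp: norm_mult)
  have "u ^ 3 = (y 1 * cnj (y 0)) * (y 2 * cnj (y 1)) * (y 0 * cnj (y 2))"
    unfolding u by (simp add: power3_eq_cube)
  also have "\<dots> = 1" using nz y012 by (simp add: cnj_eq_inverse field_simps)
  finally have "u ^ 3 = 1" .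
  then obtain k where k: "k \<in> {0,1,2}" "u = cube_root ^ nat k" by (rule cube_root_unity)
  have bal: "(c 0 + c 1 + c 2)\<^sup>2 = 3 / 2 \<and> c 0 * c 1 + c 1 * c 2 + c 2 * c 0 = 0" if "balanced y c" for c
  proof -
    have "complex_of_real (c 0 * c 1 + c 1 * c 2 + c 2 * c 0) * u = 0"
      using that unfolding balanced_def u by (simp add: algebra_simps)
    then have "c 0 * c 1 + c 1 * c 2 + c 2 * c 0 = 0"
      using \<open>cmod u = 1\<close> by (metis mult_eq_0_iff norm_zero of_real_eq_0_iff zero_neq_one)
    moreover have "(c 0 + c 1 + c 2)\<^sup>2 = (c 0)\<^sup>2 + (c 1)\<^sup>2 + (c 2)\<^sup>2 + 2 * (c 0 * c 1 + c 1 * c 2 + c 2 * c 0)"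
      by (simp add: power2_eq_square algebra_simps)
    ultimately show ?thesis using that unfolding balanced_def by simp
  qed
  define C where "C = Re (z 0) + Re (z 1) + Re (z 2)"
  define S where "S = Im (z 0) + Im (z 1) + Im (z 2)"
  define q where "q \<longleftrightarrow> S \<ge> 0"
  have C: "C = sqrt 3 / sqrt 2"
    using bal[OF re] pos unfolding C_def by (metis real_sqrt_divide real_sqrt_unique)
  have "\<bar>S\<bar> = sqrt 3 / sqrt 2"
    using bal[OF im] unfolding S_def by (metis real_sqrt_divide real_sqrt_abs)
  then have S: "S = (if q then sqrt 3 / sqrt 2 else - sqrt 3 / sqrt 2)" by (auto simp: q_def)
  have sum: "z 0 + z 1 + z 2 = complex_of_real (sqrt 3) * zeta8 q"
    using C S by (auto simp: complex_eq_iff zeta8_def C_def S_def)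
  \<comment> \<open>Dividing by the eighth root makes the sum equal to sqrt 3.\<close>
  define v where "v = (\<lambda>s. cnj (zeta8 q) * z s)"
  have zz: "zeta8 q * cnj (zeta8 q) = 1" by (simp add: complex_norm_square[symmetric])
  have zv: "z s = zeta8 q * v s" for s
    unfolding v_def mult.assoc[symmetric] zz by simp
  obtain m0 m1 m2 where
    m: "(m0, m1, m2) \<in> {(0,1,-1), (0,-1,1), (1,0,-1), (-1,0,1), (1,-1,0), (-1,1,0::int)}"
    "v 0 = bjorck_root m0" "v 1 = bjorck_root m1" "v 2 = bjorck_root m2"
  proof (rule unimodular_triple[of v])
    show "cmod (v s) = 1" if "s < 3" for s using z that by (simp add: v_def norm_mult)
    have "v 0 + v 1 + v 2 = cnj (zeta8 q) * (z 0 + z 1 + z 2)" by (simp add: v_def algebra_simps)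
    also have "\<dots> = complex_of_real (sqrt 3) * (zeta8 q * cnj (zeta8 q))"
      unfolding sum by (simp add: algebra_simps)
    finally show "v 0 + v 1 + v 2 = complex_of_real (sqrt 3)" unfolding zz by simp
    \<comment> \<open>\<open>Re T\<close> is the difference of two vanishing symmetric functions;
      division by the square of the eighth root, which is \<open>\<i>\<close> or
      \<open>- \<i>\<close>, turns a purely imaginary \<open>T\<close> into a real number.\<close>
    define T where "T = z 0 * z 1 + z 1 * z 2 + z 2 * z 0"
    have "Re T = 0"
      using bal[OF re] bal[OF im] unfolding T_def by (simp add: algebra_simps)
    have "v 0 * v 1 + v 1 * v 2 + v 2 * v 0 = (cnj (zeta8 q))\<^sup>2 * T"
      by (simp add: v_def T_def algebra_simps power2_eq_square)
    also have "(cnj (zeta8 q))\<^sup>2 = (if q then - \<i> else \<i>)"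
      by (auto simp: zeta8_def complex_eq_iff power2_eq_square field_simps)
    finally show "Im (v 0 * v 1 + v 1 * v 2 + v 2 * v 0) = 0" using \<open>Re T = 0\<close> by simp
  qed
  define c where "c = (q, [(0::int, m0), (k, m1), ((2 * k) mod 3, m2)])"
  have "c \<in> set codes"
    unfolding c_def by (rule code_intro) (use k m in \<open>auto simp: code_shape_def\<close>)
  moreover have "u\<^sup>2 = cube_root ^ nat ((2 * k) mod 3)"
    using k by (auto simp: cube_root_mult simp flip: power_mult)
  then have "torus y z = y 0 *s code_vec c"
    unfolding c_def using y1 y2 k m zv[of 0] zv[of 1] zv[of 2] by (intro torus_eq_code_vec) simp_all
  ultimately show ?thesis by blast
qed

section \<open>Reduction of the general case to the two special ones\<close>

lemma dichotomy_real_relations: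
  fixes u0 u1 u2 :: complex and a b g a' b' g' :: real
  assumes u: "cmod u0 = 1" "cmod u1 = 1" "cmod u2 = 1"
    and e: "complex_of_real a * u0 + complex_of_real b * u1 + complex_of_real g * u2 = 0"
    and e': "complex_of_real a' * u0 + complex_of_real b' * u1 + complex_of_real g' * u2 = 0"
  shows "(a * b' = a' * b \<and> b * g' = b' * g \<and> a * g' = a' * g) \<or>
    (\<exists>r1 r2 :: real. r1 \<in> {1, -1} \<and> r2 \<in> {1, -1} \<and> u1 = complex_of_real r1 * u0 \<and> u2 = complex_of_real r2 * u0)"
proof -
  \<comment> \<open>The 2x2 minors of the coefficients. Eliminating \<open>u2\<close> or
    \<open>u1\<close> shows that \<open>M12 = 0\<close> kills the others too; otherwise
    \<open>u1\<close> and \<open>u2\<close> are real multiples of \<open>u0\<close>, hence equal to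
    it up to sign.\<close>
  define M01 M12 M02 where "M01 = a * b' - a' * b" and "M12 = b * g' - b' * g" and "M02 = a * g' - a' * g"
  have 1: "complex_of_real M02 * u0 + complex_of_real M12 * u1 = 0"
    using arg_cong2[OF arg_cong[OF e, of "\<lambda>x. complex_of_real g' * x"]
        arg_cong[OF e', of "\<lambda>x. complex_of_real g * x"], of "(-)"]
    by (simp add: M02_def M12_def algebra_simps)
  have 2: "complex_of_real M01 * u0 - complex_of_real M12 * u2 = 0"
    using arg_cong2[OF arg_cong[OF e, of "\<lambda>x. complex_of_real b' * x"]
        arg_cong[OF e', of "\<lambda>x. complex_of_real b * x"], of "(-)"]
    by (simp add: M01_def M12_def algebra_simps)
  have nz: "u0 \<noteq> 0" using u by auto
  show ?thesis
  proof (cases "M12 = 0")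
    case True
    then have "M02 = 0" "M01 = 0" using 1 2 nz by simp_all
    then show ?thesis using True by (simp add: M01_def M02_def M12_def)
  next
    case False
    have sign: "r \<in> {1, -1}" if "cmod (complex_of_real r * u0) = 1" for r
      using that u by (simp add: norm_mult abs_if split: if_splits)
    have "u1 = complex_of_real (- M02 / M12) * u0" "u2 = complex_of_real (M01 / M12) * u0"
      using 1 2 False by (simp_all add: field_simps add_eq_0_iff2)
    then show ?thesis using sign u by metis
  qed
qed

text \<open>Squares at most 1 with sum 3/2 allow at most one zero. A single zero would leave just
  one term in the autocorrelation relation, and that term is nonzero.\<close>

lemma balanced_nonzero:
  assumes y: "\<And>s. s < 3 \<Longrightarrow> cmod (y s) = 1" and bal: "balanced y c" and le: "\<And>s. s < 3 \<Longrightarrow> (c s)\<^sup>2 \<le> 1"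
  shows "c 0 \<noteq> 0" "c 1 \<noteq> 0" "c 2 \<noteq> 0"
proof -
  have nz: "y 0 \<noteq> 0" "y 1 \<noteq> 0" "y 2 \<noteq> 0" using y[of 0] y[of 1] y[of 2] by auto
  have le: "(c 0)\<^sup>2 \<le> 1" "(c 1)\<^sup>2 \<le> 1" "(c 2)\<^sup>2 \<le> 1" using le by auto
  have sq: "(c 0)\<^sup>2 + (c 1)\<^sup>2 + (c 2)\<^sup>2 = 3 / 2" using bal by (simp add: balanced_def)
  have two: "\<not> (c 0 = 0 \<and> c 1 = 0)" "\<not> (c 1 = 0 \<and> c 2 = 0)" "\<not> (c 2 = 0 \<and> c 0 = 0)"
    using le sq by auto
  show "c 0 \<noteq> 0"
  proof
    assume "c 0 = 0"
    then have "c 1 * c 2 = 0" using bal nz by (simp add: balanced_def)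
    then show False using two \<open>c 0 = 0\<close> by auto
  qed
  show "c 1 \<noteq> 0"
  proof
    assume "c 1 = 0"
    then have "c 2 * c 0 = 0" using bal nz by (simp add: balanced_def)
    then show False using two \<open>c 1 = 0\<close> by auto
  qed
  show "c 2 \<noteq> 0"
  proof
    assume "c 2 = 0"
    then have "c 0 * c 1 = 0" using bal nz by (simp add: balanced_def)
    then show False using two \<open>c 2 = 0\<close> by auto
  qed
qed

text \<open>The coordinates determine each pair \<open>y s\<close>, \<open>z s\<close> only up to a
  common sign; this freedom serves to normalise the pairs.\<close>

lemma torus_sign_change:
  assumes "\<And>s. s < 3 \<Longrightarrow> e s * e s = (1::real)"
  shows "torus (\<lambda>s. complex_of_real (e s) * y s) (\<lambda>s. complex_of_real (e s) * z s) = torus y z"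
proof -
  have 1: "complex_of_real (e s) * complex_of_real (e s) = 1" if "s < 3" for s
    using assms[OF that] by (metis of_real_1 of_real_mult)
  have "complex_of_real (e s) * y s * (complex_of_real (e s) * x) = y s * x" if "s < 3" for s x
  proof -
    have "complex_of_real (e s) * y s * (complex_of_real (e s) * x)
        = complex_of_real (e s) * complex_of_real (e s) * (y s * x)" by (simp only: mult_ac)
    then show ?thesis unfolding 1[OF that] by simp
  qed
  then show ?thesis unfolding torus_def by (simp add: Let_def vec_eq_iff)
qed

lemma balanced_sign_change:
  assumes "\<And>s. s < 3 \<Longrightarrow> e s * e s = (1::real)"
  shows "balanced (\<lambda>s. complex_of_real (e s) * y s) (\<lambda>s. e s * c s) \<longleftrightarrow> balanced y c"
proof -
  have e: "e 0 * e 0 = 1" "e 1 * e 1 = 1" "e 2 * e 2 = 1" using assms by auto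
  have sq: "(e s * c s)\<^sup>2 = (c s)\<^sup>2" if "e s * e s = 1" for s
    using that by (simp add: power2_eq_square mult_ac)
  have cr: "complex_of_real (e s * c s * (e t * c t)) * (complex_of_real (e t) * y t * cnj (complex_of_real (e s) * y s))
      = complex_of_real (c s * c t) * (y t * cnj (y s))" if "e s * e s = 1" "e t * e t = 1" for s t
  proof -
    have "complex_of_real (e s * c s * (e t * c t)) * (complex_of_real (e t) * y t * cnj (complex_of_real (e s) * y s))
      = complex_of_real ((e s * e s) * (e t * e t) * (c s * c t)) * (y t * cnj (y s))"
      by (simp add: mult_ac)
    then show ?thesis unfolding that by simp
  qed
  show ?thesis
    unfolding balanced_def by (simp only: sq[OF e(1)] sq[OF e(2)] sq[OF e(3)] cr e)
qed
text \<open>The hypotheses \<open>par\<close> say that \<open>z 1\<close> and \<open>z 2\<close> are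
  real multiples of \<open>z 0\<close>, so by unimodularity they equal it up to sign. Then all
  squared real parts agree and are 1/2.\<close>

lemma balanced_parallel_parts:
  fixes z :: "nat \<Rightarrow> complex"
  assumes z: "\<And>s. s < 3 \<Longrightarrow> cmod (z s) = 1"
    and nz: "Re (z 0) \<noteq> 0" "Re (z 1) \<noteq> 0" "Re (z 2) \<noteq> 0" "Im (z 0) \<noteq> 0" "Im (z 1) \<noteq> 0" "Im (z 2) \<noteq> 0"
    and sq: "(Re (z 0))\<^sup>2 + (Re (z 1))\<^sup>2 + (Re (z 2))\<^sup>2 = 3 / 2"
    and par: "Re (z 0) * Im (z 1) = Im (z 0) * Re (z 1)" "Re (z 0) * Im (z 2) = Im (z 0) * Re (z 2)"
  obtains q where "\<And>s. s < 3 \<Longrightarrow> complex_of_real (sgn (Re (z s))) * z s = zeta8 q"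
proof -
  have unit: "(Re (z s))\<^sup>2 + (Im (z s))\<^sup>2 = 1" if "s < 3" for s
    using z[OF that] by (metis cmod_power2 one_power2)
  have eq: "(Re (z s))\<^sup>2 = (Re (z 0))\<^sup>2" if "s < 3" "Re (z 0) * Im (z s) = Im (z 0) * Re (z s)" for s
  proof -
    have "(Re (z 0))\<^sup>2 = (Re (z 0))\<^sup>2 * ((Re (z s))\<^sup>2 + (Im (z s))\<^sup>2)" using unit that by simp
    also have "\<dots> = (Re (z 0))\<^sup>2 * (Re (z s))\<^sup>2 + (Re (z 0) * Im (z s))\<^sup>2"
      by (simp add: algebra_simps power_mult_distrib)
    also have "\<dots> = (Re (z s))\<^sup>2 * ((Re (z 0))\<^sup>2 + (Im (z 0))\<^sup>2)"
      unfolding that by (simp add: algebra_simps power_mult_distrib)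
    finally show ?thesis using unit[of 0] by simp
  qed
  have cases3: "s = 0 \<or> s = 1 \<or> s = 2" if "s < 3" for s :: nat using that by auto
  have parallel: "Re (z 0) * Im (z s) = Im (z 0) * Re (z s)" if "s < 3" for s
    using cases3[OF that] par by auto
  have "(Re (z 0))\<^sup>2 = 1 / 2" using sq eq[OF _ parallel, of 1] eq[OF _ parallel, of 2] by simp
  then have half: "(Re (z s))\<^sup>2 = 1 / 2" "(Im (z s))\<^sup>2 = 1 / 2" if "s < 3" for s
    using eq[OF that parallel[OF that]] unit[OF that] by simp_all
  \<comment> \<open>The sign of the product of real and imaginary part does not change under
    negation of \<open>z s\<close>, so one \<open>q\<close> serves all \<open>s\<close>.\<close>
  have prod: "Re (z s) * Im (z s) = Re (z 0) * Im (z 0)" if "s < 3" for s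
  proof -
    have "Re (z s) * Im (z s) = 2 * (Re (z 0))\<^sup>2 * (Re (z s) * Im (z s))" using half[of 0] by simp
    also have "\<dots> = 2 * Re (z 0) * Re (z s) * (Re (z 0) * Im (z s))" by (simp add: power2_eq_square)
    also have "\<dots> = 2 * (Re (z s))\<^sup>2 * (Re (z 0) * Im (z 0))"
      unfolding parallel[OF that] by (simp add: power2_eq_square)
    finally show ?thesis using half[OF that] by simp
  qed
  define q where "q \<longleftrightarrow> Re (z 0) * Im (z 0) > 0"
  have "complex_of_real (sgn (Re (z s))) * z s = zeta8 q" if s: "s < 3" for s
  proof -
    have c: "\<bar>Re (z s)\<bar> = 1 / sqrt 2" and d: "\<bar>Im (z s)\<bar> = 1 / sqrt 2"
      using half[OF s] by (metis real_sqrt_abs real_sqrt_divide real_sqrt_one)+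
    have "Re (z s) \<noteq> 0" "Im (z s) \<noteq> 0" using c d by auto
    moreover have "q \<longleftrightarrow> Re (z s) * Im (z s) > 0" unfolding q_def prod[OF s] ..
    ultimately have "sgn (Re (z s)) * Re (z s) = 1 / sqrt 2"
      "sgn (Re (z s)) * Im (z s) = (if q then 1 / sqrt 2 else - 1 / sqrt 2)"
      using c d by (auto simp: sgn_real_def abs_if zero_less_mult_iff split: if_splits)
    then show ?thesis by (simp add: complex_eq_iff zeta8_def)
  qed
  then show thesis using that by blast
qed

lemma classify_torus:
  assumes y: "\<And>s. s < 3 \<Longrightarrow> cmod (y s) = 1" and z: "\<And>s. s < 3 \<Longrightarrow> cmod (z s) = 1"
    and bi: "biunimodular (torus y z)"
  shows "\<exists>c\<in>set codes. \<exists>k. cmod k = 1 \<and> torus y z = k *s code_vec c"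
proof -
  have re: "balanced y (\<lambda>s. Re (z s))" and im: "balanced y (\<lambda>s. Im (z s))"
    using bi biunimodular_torus_iff[OF y z] by auto
  have unit: "(Re (z s))\<^sup>2 + (Im (z s))\<^sup>2 = 1" if "s < 3" for s
    using z[OF that] by (metis cmod_power2 one_power2)
  then have le: "(Re (z s))\<^sup>2 \<le> 1" "(Im (z s))\<^sup>2 \<le> 1" if "s < 3" for s
    using that by (smt (verit) zero_le_power2)+
  note nzR = balanced_nonzero[OF y re le(1)]
  note nzI = balanced_nonzero[OF y im le(2)]
  define u0 u1 u2 where "u0 = y 1 * cnj (y 0)" and "u1 = y 2 * cnj (y 1)" and "u2 = y 0 * cnj (y 2)"
  have u: "cmod u0 = 1" "cmod u1 = 1" "cmod u2 = 1"
    unfolding u0_def u1_def u2_def using y[of 0] y[of 1] y[of 2] by (simp_all add: norm_mult)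
  \<comment> \<open>The coefficients of the two relations are cyclic products of two real parts and
    of two imaginary parts of \<open>z\<close>.\<close>
  note d = dichotomy_real_relations[OF u re[unfolded balanced_def, THEN conjunct2, folded u0_def u1_def u2_def]
      im[unfolded balanced_def, THEN conjunct2, folded u0_def u1_def u2_def]]
  have "\<exists>e c. (\<forall>s<3. e s * e s = (1::real)) \<and> c \<in> set codes \<and>
      torus (\<lambda>s. complex_of_real (e s) * y s) (\<lambda>s. complex_of_real (e s) * z s)
        = (complex_of_real (e 0) * y 0) *s code_vec c"
    using d
  proof (elim disjE conjE exE)
    let ?c = "\<lambda>s. Re (z s)" and ?d = "\<lambda>s. Im (z s)"
    assume m: "?c 0 * ?c 1 * (?d 1 * ?d 2) = ?d 0 * ?d 1 * (?c 1 * ?c 2)"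
      "?c 0 * ?c 1 * (?d 2 * ?d 0) = ?d 0 * ?d 1 * (?c 2 * ?c 0)"
    \<comment> \<open>Cancelling the nonzero common factors from the minors shows that the vectors
      of real and of imaginary parts are themselves parallel.\<close>
    have "?c 1 * ?d 1 * (?c 0 * ?d 2) = ?c 1 * ?d 1 * (?d 0 * ?c 2)"
      using m(1) by (simp only: mult_ac)
    then have p2: "?c 0 * ?d 2 = ?d 0 * ?c 2" using nzR nzI by simp
    have "?c 0 * ?d 0 * (?c 1 * ?d 2) = ?c 0 * ?d 0 * (?d 1 * ?c 2)"
      using m(2) by (simp only: mult_ac)
    then have "?c 1 * ?d 2 = ?d 1 * ?c 2" using nzR nzI by simp
    then have "?c 2 * (?c 0 * ?d 1) = ?c 0 * (?c 1 * ?d 2)" by (simp add: mult_ac)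
    also have "\<dots> = ?c 2 * (?d 0 * ?c 1)" using p2 by (simp add: mult_ac)
    finally have p1: "?c 0 * ?d 1 = ?d 0 * ?c 1" using nzR by simp
    define e where "e s = sgn (Re (z s))" for s
    have "s = 0 \<or> s = 1 \<or> s = 2" if "s < 3" for s :: nat using that by auto
    then have ee: "e s * e s = 1" if "s < 3" for s
      using nzR that unfolding e_def by (fastforce simp: sgn_real_def)
    obtain q where q: "\<And>s. s < 3 \<Longrightarrow> complex_of_real (e s) * z s = zeta8 q"
      unfolding e_def using balanced_parallel_parts[OF z nzR nzI _ p1 p2] re unfolding balanced_def by blast
    have "balanced (\<lambda>s. complex_of_real (e s) * y s) (\<lambda>s. e s * Re (z s))"
      using balanced_sign_change[OF ee] re by simp
    then have "\<exists>c\<in>set codes. torus (\<lambda>s. complex_of_real (e s) * y s) (\<lambda>s. complex_of_real (e s) * z s)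
        = (complex_of_real (e 0) * y 0) *s code_vec c"
    proof (intro classify_gaussian)
      show "cmod (complex_of_real (e s) * y s) = 1" if "s < 3" for s
        using ee[OF that] y[OF that] by (auto simp: norm_mult square_eq_1_iff)
    qed (use q in auto)
    then show ?thesis using ee by blast
  next
    fix r1 r2 :: real
    assume r: "r1 \<in> {1, -1}" "r2 \<in> {1, -1}" "u1 = complex_of_real r1 * u0" "u2 = complex_of_real r2 * u0"
    \<comment> \<open>A global sign that secures the positivity assumption of
      \<open>classify_linear\<close>.\<close>
    define t where "t = (if r1 * Re (z 0) + r2 * Re (z 1) + Re (z 2) \<ge> 0 then 1 else -1 :: real)"
    have t: "t = 1 \<or> t = -1" by (simp add: t_def)
    \<comment> \<open>Chosen so that the products of neighbouring signs are \<open>r1 * r2\<close>,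
      \<open>r2\<close> and \<open>r1\<close>, which turns all three ratios into
      \<open>r1 * r2 * u0\<close>.\<close>
    define e where "e s = (if s = 0 then t * r1 else if s = 1 then t * r2 else t)" for s :: nat
    have ee: "e s * e s = 1" for s using r t by (auto simp: e_def)
    have e: "e 0 = t * r1" "e 1 = t * r2" "e 2 = t" by (simp_all add: e_def)
    let ?y = "\<lambda>s. complex_of_real (e s) * y s" and ?z = "\<lambda>s. complex_of_real (e s) * z s"
    have "\<exists>c\<in>set codes. torus ?y ?z = ?y 0 *s code_vec c"
    proof (rule classify_linear[where u = "complex_of_real (r1 * r2) * u0"])
      show "cmod (?y s) = 1" "cmod (?z s) = 1" if "s < 3" for s
        using ee[of s] y[OF that] z[OF that] by (auto simp: norm_mult square_eq_1_iff)
      have y': "?y i * cnj (?y j) = complex_of_real (e i * e j) * (y i * cnj (y j))" for i j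
        by simp
      have "e 1 * e 0 = r1 * r2" "e 2 * e 1 = r2" "e 0 * e 2 = r1" unfolding e using t by auto
      then show "?y 1 * cnj (?y 0) = complex_of_real (r1 * r2) * u0"
        "?y 2 * cnj (?y 1) = complex_of_real (r1 * r2) * u0"
        "?y 0 * cnj (?y 2) = complex_of_real (r1 * r2) * u0"
        unfolding y' u0_def[symmetric] u1_def[symmetric] u2_def[symmetric] r(3,4) by simp_all
      show "balanced ?y (\<lambda>s. Re (?z s))" "balanced ?y (\<lambda>s. Im (?z s))"
        using balanced_sign_change[OF ee, where y = y] re im by simp_all
      have "Re (?z 0) + Re (?z 1) + Re (?z 2) = t * (r1 * Re (z 0) + r2 * Re (z 1) + Re (z 2))"
        using e by (simp add: algebra_simps)
      then show "Re (?z 0) + Re (?z 1) + Re (?z 2) \<ge> 0" by (simp add: t_def)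
    qed
    then show ?thesis using ee by blast
  qed
  then obtain e c where e: "\<And>s. s < 3 \<Longrightarrow> e s * e s = (1::real)" and c: "c \<in> set codes"
    and eq: "torus (\<lambda>s. complex_of_real (e s) * y s) (\<lambda>s. complex_of_real (e s) * z s)
        = (complex_of_real (e 0) * y 0) *s code_vec c"
    by blast
  have "cmod (complex_of_real (e 0) * y 0) = 1"
    using e[of 0] y[of 0] by (auto simp: norm_mult square_eq_1_iff)
  moreover have "torus y z = (complex_of_real (e 0) * y 0) *s code_vec c"
    using eq torus_sign_change[of e y z] e by simp
  ultimately show ?thesis using c by blast
qed

theorem biunimodular_classification:
  assumes "biunimodular x"
  shows "\<exists>c\<in>set codes. \<exists>k. cmod k = 1 \<and> x = k *s code_vec c"
proof -
  let ?r = "complex_of_real (sqrt 6)"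
  have n: "cmod (?r * x $ k) = 1" for k
  proof -
    have "(cmod (x $ k))\<^sup>2 = 1 / 6" using assms by (simp add: biunimodular_def)
    then have "(cmod (?r * x $ k))\<^sup>2 = 1" by (simp add: norm_mult power_mult_distrib)
    then show ?thesis by (simp add: power2_eq_1_iff) (smt (verit) norm_ge_zero)
  qed
  \<comment> \<open>\<open>A s\<close> and \<open>B s\<close> are the rescaled coordinates at the
    even and at the odd index with residue \<open>s\<close> modulo 3.\<close>
  define A B where "A s = ?r * x $ (if s = 0 then 0 else if s = 1 then 4 else 2)"
    and "B s = ?r * x $ (if s = 0 then 3 else if s = 1 then 1 else 5)" for s :: nat
  have AB: "cmod (A s) = 1" "cmod (B s) = 1" for s unfolding A_def B_def by (rule n)+
  \<comment> \<open>Solves \<open>y s * z s = A s\<close> and \<open>y s * cnj (z s) = B s\<close>: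
    for unimodular \<open>z s\<close> the quotient of the two is the square of
    \<open>z s\<close>.\<close>
  define z where "z s = csqrt (A s / B s)" for s
  define y where "y s = B s * z s" for s
  have "(cmod (z s))\<^sup>2 = 1" for s
    unfolding z_def norm_power[symmetric] using AB by (simp add: norm_divide)
  then have z: "cmod (z s) = 1" for s by (simp add: power2_eq_1_iff) (smt (verit) norm_ge_zero)
  have y: "cmod (y s) = 1" for s using AB z by (simp add: y_def norm_mult)
  have "y s * z s = B s * (z s)\<^sup>2" for s by (simp add: y_def power2_eq_square)
  then have yz: "y s * z s = A s" for s using AB[of s] by (auto simp: z_def)
  have "z s * cnj (z s) = 1" for s using z by (simp add: complex_norm_square[symmetric])
  then have yz': "y s * cnj (z s) = B s" for s by (simp add: y_def mult.assoc)
  have "1 / sqrt 6 * sqrt 6 = 1" by simp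
  then have r: "complex_of_real (1 / sqrt 6) * (?r * a) = a" for a
    by (metis mult.assoc mult_1 of_real_1 of_real_mult)
  have "\<forall>k. torus y z $ k = x $ k"
    unfolding forall_6 torus_nth yz yz' unfolding A_def B_def r by simp
  then have "torus y z = x" by (simp add: vec_eq_iff)
  then show ?thesis using classify_torus[of y z] y z assms by simp
qed

subsection \<open>Orthogonality of the vectors described by the codes\<close>

fun quad_val :: "quad \<Rightarrow> real" where
  "quad_val (Quad a b c d) = a + b * sqrt 3 + (c + d * sqrt 3) * beta"

text \<open>Infinite descent: 3 divides \<open>a\<close>, hence \<open>b\<close>, and the quotients
  satisfy the same equation.\<close>

lemma square_eq_3_times_square:
  fixes a b :: int
  assumes "a * a = 3 * (b * b)"
  shows "b = 0"
  using assms
proof (induction "nat \<bar>b\<bar>" arbitrary: a b rule: less_induct)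
  case less
  have dvd: "3 dvd x" if "3 dvd x * x" for x :: int
    using that by (simp add: prime_dvd_mult_iff)
  obtain a' where a: "a = 3 * a'" using dvd[of a] less.prems by (metis dvdE dvd_triv_left)
  then have "b * b = 3 * (a' * a')" using less.prems by simp
  then obtain b' where b: "b = 3 * b'" using dvd[of b] by (metis dvdE dvd_triv_left)
  have "a' * a' = 3 * (b' * b')" using \<open>b * b = 3 * (a' * a')\<close> b by simp
  show ?case
  proof (rule ccontr)
    assume "b \<noteq> 0"
    then have "nat \<bar>b'\<bar> < nat \<bar>b\<bar>" using b by linarith
    then have "b' = 0" using \<open>a' * a' = 3 * (b' * b')\<close> by (rule less.hyps)
    then show False using b \<open>b \<noteq> 0\<close> by simp
  qed
qed

lemma sqrt3_independent:
  fixes a b :: int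
  assumes "a + b * sqrt 3 = 0"
  shows "a = 0" "b = 0"
proof -
  have "real_of_int a = - b * sqrt 3" using assms by linarith
  then have "real_of_int (a * a) = real_of_int (3 * (b * b))" by (simp add: mult_ac)
  then have "a * a = 3 * (b * b)" by (simp only: of_int_eq_iff)
  then show "b = 0" by (rule square_eq_3_times_square)
  then show "a = 0" using assms by simp
qed

text \<open>Applying the conjugation of \<open>\<rat>(\<surd>3)\<close> to \<open>P\<^sup>2 = Q\<^sup>2 \<surd>3 / 2\<close> makes the right-hand side
  nonpositive.\<close>

lemma quad_val_eq_0:
  assumes "quad_val (Quad a b c d) = 0"
  shows "Quad a b c d = Quad 0 0 0 0"
proof -
  define r where "r = sqrt 3"
  have rr: "r * r = 3" by (simp add: r_def)
  have "a + b * r = - ((c + d * r) * beta)" using assms by (simp add: r_def)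
  then have "(a + b * r) * (a + b * r) = (c + d * r) * (c + d * r) * (beta * beta)" by simp
  then have "2 * ((a + b * r) * (a + b * r)) = (c + d * r) * (c + d * r) * r"
    unfolding beta_sq by (simp add: r_def)
  moreover have "(a + b * r) * (a + b * r) = a * a + b * b * (r * r) + 2 * a * b * r"
    by (simp add: algebra_simps)
  moreover have "(c + d * r) * (c + d * r) * r = (c * c + d * d * (r * r)) * r + 2 * c * d * (r * r)"
    by (simp add: algebra_simps)
  ultimately have "real_of_int (2 * (a * a) + 6 * (b * b) - 6 * (c * d))
      + real_of_int (4 * (a * b) - (c * c) - 3 * (d * d)) * sqrt 3 = 0"
    unfolding rr by (simp add: r_def algebra_simps)
  note ind = sqrt3_independent[OF this]
  have 1: "real_of_int (2 * (a * a) + 6 * (b * b)) = real_of_int (6 * (c * d))"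
    and 2: "real_of_int (4 * (a * b)) = real_of_int (c * c + 3 * (d * d))"
    using ind by (simp_all only: of_int_eq_iff)
  have "2 * ((a - b * r) * (a - b * r)) = real_of_int (2 * (a * a)) + 2 * (b * b) * (r * r) - real_of_int (4 * (a * b)) * r"
    by (simp add: algebra_simps)
  also have "\<dots> = real_of_int (6 * (c * d)) - real_of_int (c * c + 3 * (d * d)) * r"
    unfolding rr using 1 2 by simp
  also have "\<dots> = - ((c - d * r) * (c - d * r) * r)"
  proof -
    have "(c - d * r) * (c - d * r) * r = real_of_int (c * c) * r + d * d * (r * r) * r - 2 * c * d * (r * r)"
      by (simp add: algebra_simps)
    then show ?thesis unfolding rr by (simp add: algebra_simps)
  qed
  finally have e: "2 * ((a - b * r) * (a - b * r)) = - ((c - d * r) * (c - d * r) * r)" .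
  have "(c - d * r) * (c - d * r) * r \<ge> 0" by (simp add: r_def)
  moreover have "(a - b * r) * (a - b * r) \<ge> 0" by simp
  ultimately have "(a - b * r) * (a - b * r) = 0" "(c - d * r) * (c - d * r) * r = 0" using e by linarith+
  then have "a + of_int (- b) * sqrt 3 = 0" "c + of_int (- d) * sqrt 3 = 0" by (simp_all add: r_def)
  then show ?thesis using sqrt3_independent[of a "- b"] sqrt3_independent[of c "- d"] by simp
qed

lemma quad_val_plus: "quad_val (quad_plus x y) = quad_val x + quad_val y"
  by (cases x; cases y) (simp add: algebra_simps)

lemma quad_val_inj: "quad_val x = quad_val y \<longleftrightarrow> x = y"
proof
  assume e: "quad_val x = quad_val y"
  obtain a b c d a' b' c' d' where xy: "x = Quad a b c d" "y = Quad a' b' c' d'"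
    by (cases x; cases y)
  have "quad_val (Quad (a - a') (b - b') (c - c') (d - d')) = 0"
    using e by (simp add: xy algebra_simps)
  from quad_val_eq_0[OF this] show "x = y" by (simp add: xy)
qed simp

text \<open>As \<open>bjorck\<close> is unimodular, only the exponent difference matters. The eighth
  roots contribute 1, \<open>\<i>\<close> or \<open>- \<i>\<close>, so the table lists real parts of
  powers of \<open>bjorck\<close> for equal signs and signed imaginary parts otherwise.\<close>

lemma re_table_correct:
  assumes m: "m \<in> {0,1,-1}" "m' \<in> {0,1,-1}"
  shows "quad_val (re_table q q' (m' - m)) =
    2 * Re (cnj (zeta8 q * bjorck_root m) * (zeta8 q' * bjorck_root m'))"
proof -
  define E where "E = cnj (bjorck_root m) * bjorck_root m'"
  define k where "k = m' - m"
  have bb: "bjorck * bjorck = Complex (1 - sqrt 3) ((sqrt 3 - 1) * beta)"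
    by (simp add: bjorck_def complex_eq_iff beta_sq field_simps)
  have cc: "cnj bjorck * cnj bjorck = Complex (1 - sqrt 3) (- ((sqrt 3 - 1) * beta))"
    unfolding complex_cnj_mult[symmetric] bb by (simp add: complex_eq_iff)
  have bc: "cnj bjorck * bjorck = 1" "bjorck * cnj bjorck = 1"
    using norm_bjorck by (simp_all add: complex_norm_square[symmetric] mult.commute[of "cnj bjorck"])
  have E: "E = Complex (if k = 0 then 1 else if k = 1 \<or> k = -1 then (sqrt 3 - 1) / 2 else 1 - sqrt 3)
     (if k = 0 then 0 else if k = 1 then beta else if k = -1 then - beta
      else if k = 2 then (sqrt 3 - 1) * beta else - ((sqrt 3 - 1) * beta))"
    using m unfolding E_def k_def
    by (elim insertE emptyE; simp add: bjorck_root_def bb cc bc; simp add: bjorck_def complex_eq_iff)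
  have k: "k = 0 \<or> k = 1 \<or> k = -1 \<or> k = 2 \<or> k = -2" using m unfolding k_def by auto
  have "cnj (zeta8 q * bjorck_root m) * (zeta8 q' * bjorck_root m') = (cnj (zeta8 q) * zeta8 q') * E"
    by (simp add: E_def mult_ac)
  also have "cnj (zeta8 q) * zeta8 q' = (if q = q' then 1 else if q then - \<i> else \<i>)"
    by (auto simp: zeta8_def complex_eq_iff)
  finally have "Re (cnj (zeta8 q * bjorck_root m) * (zeta8 q' * bjorck_root m'))
      = (if q = q' then Re E else if q then Im E else - Im E)"
    by simp
  then show ?thesis
    using k unfolding k_def[symmetric] E re_table_def Let_def
    by (elim disjE; cases q; cases q'; simp add: algebra_simps)
qed

lemma cube_root_cnj_mult:
  assumes n: "n \<in> {0,1,2}" "n' \<in> {0,1,2::int}"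
  shows "cnj (cube_root ^ nat n) * cube_root ^ nat n' =
    (if (n' - n) mod 3 = 0 then 1 else if (n' - n) mod 3 = 1 then cube_root else cube_root\<^sup>2)"
proof -
  have "cnj cube_root = cube_root\<^sup>2" "cnj (cube_root\<^sup>2) = cube_root"
    by (simp_all only: omega6_powers(9)) (simp_all add: cube_root_def complex_eq_iff)
  then show ?thesis using n by (elim insertE emptyE; simp add: cube_root_mult del: complex_cnj_power)
qed

text \<open>Up to scaling, the only real relation between the three cube roots of unity is that they
  sum to zero; \<open>quad_val_inj\<close> then turns equality of the real coefficients into
  equality of integer quadruples.\<close>

lemma orth_iff:
  assumes "c \<in> set codes" "c' \<in> set codes"
  shows "orth c c' \<longleftrightarrow> braket (code_vec c) (code_vec c') = 0"
  using assms(1)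
proof (cases rule: code_cases)
  case c: (1 q m0 n1 m1 n2 m2)
  show ?thesis using assms(2)
  proof (cases rule: code_cases)
    case c': (1 q' m0' n1' m1' n2' m2')
    define R where "R m m' = quad_val (re_table q q' (m' - m))" for m m'
    define A where "A i = quad_val (part i c c')" for i
    have A: "A i = (if i = 0 then R m0 m0' else 0) + (if (n1' - n1) mod 3 = i then R m1 m1' else 0)
        + (if (n2' - n2) mod 3 = i then R m2 m2' else 0)" for i
      unfolding A_def part_def c(1) c'(1) by (simp add: quad_val_plus R_def)
    have w: "cnj (cube_root ^ nat n) * cube_root ^ nat n' * complex_of_real (R m m' / 2) =
       (complex_of_real (if (n' - n) mod 3 = 0 then R m m' else 0)
        + cube_root * complex_of_real (if (n' - n) mod 3 = 1 then R m m' else 0)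
        + cube_root\<^sup>2 * complex_of_real (if (n' - n) mod 3 = 2 then R m m' else 0)) / 2"
      if "n \<in> {0,1,2}" "n' \<in> {0,1,2}" for n n' m m'
    proof -
      have "(n' - n) mod 3 = 0 \<or> (n' - n) mod 3 = 1 \<or> (n' - n) mod 3 = 2" by presburger
      then show ?thesis unfolding cube_root_cnj_mult[OF that] by (elim disjE) simp_all
    qed
    have R: "complex_of_real (Re (cnj (zeta8 q * bjorck_root m) * (zeta8 q' * bjorck_root m')))
        = complex_of_real (R m m' / 2)" if "m \<in> {0,1,-1}" "m' \<in> {0,1,-1}" for m m'
      using re_table_correct[OF that] by (simp add: R_def)
    have sum3: "(\<Sum>s<(3::nat). f s) = f 0 + f 1 + f 2" for f :: "nat \<Rightarrow> complex"
      by (simp add: numeral_3_eq_3 numeral_2_eq_2)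
    have nth: "[a, b, d] ! 0 = a" "[a, b, d] ! 1 = b" "[a, b, d] ! 2 = d" for a b d :: "int \<times> int"
      by simp_all
    have "braket (code_vec c) (code_vec c') =
      (1 / 3) * (cnj (cube_root ^ nat 0) * cube_root ^ nat 0 * complex_of_real (R m0 m0' / 2)
        + cnj (cube_root ^ nat n1) * cube_root ^ nat n1' * complex_of_real (R m1 m1' / 2)
        + cnj (cube_root ^ nat n2) * cube_root ^ nat n2' * complex_of_real (R m2 m2' / 2))"
      unfolding code_vec_def braket_torus sum3 c(1) c'(1) snd_conv fst_conv nth
        R[OF c(4) c'(4)] R[OF c(5) c'(5)] R[OF c(6) c'(6)] ..
    also have "\<dots> = (complex_of_real (A 0) + cube_root * complex_of_real (A 1) + cube_root\<^sup>2 * complex_of_real (A 2)) / 6"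
      unfolding w[OF c(2) c'(2)] w[OF c(3) c'(3)] A by (simp add: algebra_simps add_divide_distrib)
    finally have "braket (code_vec c) (code_vec c') = 0 \<longleftrightarrow>
        complex_of_real (A 0) + cube_root * complex_of_real (A 1) + cube_root\<^sup>2 * complex_of_real (A 2) = 0"
      by (simp only: divide_eq_0_iff) simp
    also have "\<dots> \<longleftrightarrow> A 0 = A 1 \<and> A 1 = A 2"
      unfolding omega6_powers(9) unfolding cube_root_def by (auto simp: complex_eq_iff algebra_simps)
    finally show ?thesis unfolding A_def orth_def quad_val_inj by simp
  qed
qed

subsection \<open>Orthonormal bases and eigenbases\<close>

lemma norm_eq_1_iff: "cmod k = 1 \<longleftrightarrow> k * cnj k = 1"
proof -
  have "k * cnj k = 1 \<longleftrightarrow> (cmod k)\<^sup>2 = 1"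
    unfolding complex_norm_square[symmetric] of_real_eq_1_iff ..
  also have "\<dots> \<longleftrightarrow> cmod k = 1"
    by (simp add: power2_eq_1_iff) (smt (verit) norm_ge_zero)
  finally show ?thesis ..
qed

lemma braket_add_right: "braket u (v + w) = braket u v + braket u w"
  by (simp add: braket_def distrib_left sum.distrib)

lemma braket_scale_right: "braket u (c *s v) = c * braket u v"
  by (simp add: braket_def sum_distrib_left mult_ac)

lemma braket_scale_left: "braket (c *s u) v = cnj c * braket u v"
  by (simp add: braket_def sum_distrib_left mult_ac)

lemma braket_sum_right: "braket u (\<Sum>i\<in>I. f i) = (\<Sum>i\<in>I. braket u (f i))"
  unfolding braket_def sum_component sum_distrib_left by (rule sum.swap)

lemma braket_zero_right [simp]: "braket u 0 = 0"
  by (simp add: braket_def)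

lemma cnj_braket: "cnj (braket u v) = braket v u"
  by (simp add: braket_def mult.commute)

lemma braket_self: "braket v v = complex_of_real ((norm v)\<^sup>2)"
proof -
  have "(norm v)\<^sup>2 = (\<Sum>i\<in>UNIV. (cmod (v $ i))\<^sup>2)"
    by (simp add: norm_vec_def L2_set_def sum_nonneg)
  then show ?thesis by (simp only: of_real_sum complex_norm_square) (simp add: braket_def mult.commute)
qed

text \<open>Orthonormality is \<open>A ** B = mat 1\<close> and completeness is
  \<open>B ** A = mat 1\<close>; for square matrices each implies the other.\<close>

lemma orthonormal_expansion:
  fixes f :: "'n::finite \<Rightarrow> complex ^ 'n"
  assumes "\<And>i j. braket (f i) (f j) = (if i = j then 1 else 0)"
  shows "v = (\<Sum>i\<in>UNIV. braket (f i) v *s f i)"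
proof -
  define A :: "complex ^ 'n ^ 'n" where "A = (\<chi> i j. cnj (f i $ j))"
  define B :: "complex ^ 'n ^ 'n" where "B = (\<chi> i j. f j $ i)"
  have "A ** B = mat 1"
    using assms by (simp add: vec_eq_iff matrix_matrix_mult_def mat_def A_def B_def braket_def)
  then have "B ** A = mat 1" using matrix_left_right_inverse by blast
  then have "v = B *v (A *v v)" by (simp add: matrix_vector_mul_assoc)
  also have "A *v v = (\<chi> i. braket (f i) v)"
    by (simp add: vec_eq_iff matrix_vector_mult_def A_def braket_def)
  also have "B *v (\<chi> i. braket (f i) v) = (\<Sum>i\<in>UNIV. braket (f i) v *s f i)"
    by (simp add: vec_eq_iff matrix_vector_mult_def B_def sum_component mult.commute)
  finally show ?thesis .
qed

lemma parseval:
  fixes f :: "'n::finite \<Rightarrow> complex ^ 'n"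
  assumes "\<And>i j. braket (f i) (f j) = (if i = j then 1 else 0)"
  shows "braket u v = (\<Sum>i\<in>UNIV. cnj (braket (f i) u) * braket (f i) v)"
proof -
  have "braket u v = braket u (\<Sum>i\<in>UNIV. braket (f i) v *s f i)"
    using orthonormal_expansion[OF assms, of v] by simp
  also have "\<dots> = (\<Sum>i\<in>UNIV. cnj (braket (f i) u) * braket (f i) v)"
    by (simp add: braket_sum_right braket_scale_right cnj_braket mult.commute)
  finally show ?thesis .
qed

definition orthonormal :: "(complex ^ 'n) set \<Rightarrow> bool"
  where "orthonormal C \<longleftrightarrow> (\<forall>u\<in>C. \<forall>v\<in>C. braket u v = (if u = v then 1 else 0))"

lemma orthonormal_UNIV_card:
  fixes C :: "(complex ^ 'n::finite) set"
  assumes C: "orthonormal C" and card: "card C = CARD('n)"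
  shows "vec.span C = UNIV" "\<And>v. (\<And>u. u \<in> C \<Longrightarrow> braket u v = 0) \<Longrightarrow> v = 0"
proof -
  have "finite C" using card by (metis card.infinite zero_less_card_finite less_irrefl)
  then obtain f :: "'n \<Rightarrow> complex ^ 'n" where f: "bij_betw f UNIV C"
    using card by (metis finite_same_card_bij finite)
  have fC: "f i \<in> C" for i using f by (auto simp: bij_betw_def)
  have "f i = f j \<longleftrightarrow> i = j" for i j using f by (auto simp: bij_betw_def inj_eq)
  then have on: "braket (f i) (f j) = (if i = j then 1 else 0)" for i j
    using C fC[of i] fC[of j] unfolding orthonormal_def by auto
  have "v \<in> vec.span C" for v
    by (subst orthonormal_expansion[OF on, of v])
      (intro vec.span_sum vec.span_scale vec.span_base fC)
  then show "vec.span C = UNIV" by auto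
  show "v = 0" if "\<And>u. u \<in> C \<Longrightarrow> braket u v = 0" for v
    using orthonormal_expansion[OF on, of v] that fC by simp
qed

lemma orthonormal_card_le:
  fixes C :: "(complex ^ 'n::finite) set"
  assumes C: "orthonormal C"
  shows "finite C \<and> card C \<le> CARD('n)"
proof (rule ccontr)
  assume "\<not> ?thesis"
  then have "\<exists>D\<subseteq>C. finite D \<and> card D = Suc CARD('n)"
    by (metis infinite_arbitrarily_large not_less_eq_eq obtain_subset_with_card_n)
  then obtain D where D: "D \<subseteq> C" "finite D" "card D = Suc CARD('n)" by blast
  then obtain w E where E: "D = insert w E" "w \<notin> E" "card E = CARD('n)"
    by (auto simp: card_Suc_eq)
  have "E \<subseteq> C" using D E by auto
  then have "orthonormal E" using C unfolding orthonormal_def by blast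
  moreover have "braket u w = 0" if "u \<in> E" for u
    using that C D E by (auto simp: orthonormal_def)
  ultimately have "w = 0" using orthonormal_UNIV_card(2)[of E w] E by blast
  moreover have "braket w w = 1" using C D E by (auto simp: orthonormal_def)
  ultimately show False by simp
qed

text \<open>Replaces the spanning condition by a cardinality, the form in which bases become cliques
  of size 6.\<close>

lemma orthonormal_basis_iff:
  fixes C :: "(complex ^ 'n::finite) set"
  shows "orthonormal_basis C \<longleftrightarrow> orthonormal C \<and> card C = CARD('n)"
proof
  assume o: "orthonormal_basis C"
  then have C: "orthonormal C" "vec.span C = UNIV" by (auto simp: orthonormal_basis_def orthonormal_def)
  have "vec.dim (UNIV :: (complex ^ 'n) set) \<le> card C"
    using C orthonormal_card_le[OF C(1)] by (intro vec.dim_le_card) auto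
  then have "CARD('n) \<le> card C" by (simp add: card_cart_basis)
  then show "orthonormal C \<and> card C = CARD('n)" using orthonormal_card_le[OF C(1)] C(1) by simp
next
  assume "orthonormal C \<and> card C = CARD('n)"
  then show "orthonormal_basis C"
    using orthonormal_UNIV_card(1)[of C] by (auto simp: orthonormal_basis_def orthonormal_def)
qed

section \<open>Isometries with simple spectrum\<close>

locale simple_spectrum =
  fixes T :: "complex ^ 'n ^ 'n" and f :: "'n::finite \<Rightarrow> complex ^ 'n" and l :: "'n \<Rightarrow> complex"
  assumes isometry: "\<And>x y. braket (T *v x) (T *v y) = braket x y"
    and eigen: "\<And>i. T *v f i = l i *s f i"
    and simple: "\<And>i j. l i = l j \<Longrightarrow> i = j"
    and unit: "\<And>i. braket (f i) (f i) = 1"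
begin

lemma norm_eigenvalue: "cmod (l i) = 1"
proof -
  have "l i * cnj (l i) = 1"
    using isometry[of "f i" "f i"] unit[of i] by (simp add: eigen braket_scale_left braket_scale_right)
  then show ?thesis unfolding norm_eq_1_iff .
qed

text \<open>Applying the isometry multiplies the nonzero overlap by \<open>m * cnj (l i)\<close>,
  which must therefore be 1.\<close>

lemma eigenvector_braket:
  assumes "T *v w = m *s w" "braket (f i) w \<noteq> 0"
  shows "m = l i"
proof -
  have "m * cnj (l i) = 1"
    using isometry[of "f i" w] assms by (simp add: eigen braket_scale_left braket_scale_right)
  then show ?thesis using norm_eigenvalue[of i] by (auto simp: cnj_eq_inverse field_simps)
qed

lemma orthonormal_eigenvectors: "braket (f i) (f j) = (if i = j then 1 else 0)"
  using eigenvector_braket[OF eigen, of i j] simple unit by metis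

lemma eigenvector_scale:
  assumes "T *v w = l i *s w"
  shows "w = braket (f i) w *s f i"
proof -
  have z: "braket (f j) w = 0" if "j \<noteq> i" for j
    using eigenvector_braket[OF assms, of j] simple that by metis
  have "(\<Sum>j\<in>UNIV. braket (f j) w *s f j) = (\<Sum>j\<in>UNIV. if j = i then braket (f i) w *s f i else 0)"
    using z by (intro sum.cong) auto
  then show ?thesis using orthonormal_expansion[OF orthonormal_eigenvectors, of w] by simp
qed

lemma norm_scale:
  assumes "braket w w = 1" "w = k *s f i"
  shows "cmod k = 1"
proof -
  have "k * cnj k = 1"
    using assms unit[of i] by (simp add: braket_scale_left braket_scale_right)
  then show ?thesis by (simp add: norm_eq_1_iff)
qed

lemma eigenbasis_mem:
  assumes B: "eigenbasis T B" and w: "w \<in> B"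
  shows "\<exists>i k. cmod k = 1 \<and> w = k *s f i"
proof -
  have 1: "braket w w = 1" using B w by (auto simp: eigenbasis_def orthonormal_basis_def)
  obtain m where m: "T *v w = m *s w" using B w by (auto simp: eigenbasis_def eigenvector_def)
  have "\<exists>i. braket (f i) w \<noteq> 0"
  proof (rule ccontr)
    assume "\<not> ?thesis"
    then have "w = 0" using orthonormal_expansion[OF orthonormal_eigenvectors, of w] by simp
    then show False using 1 by simp
  qed
  then obtain i where "braket (f i) w \<noteq> 0" ..
  then have "w = braket (f i) w *s f i" using eigenvector_braket[OF m] eigenvector_scale m by metis
  then show ?thesis using norm_scale[OF 1] by blast
qed

text \<open>Otherwise every member of \<open>B\<close>, and so its whole span, would be orthogonal
  to \<open>f i\<close>.\<close>

lemma eigenbasis_covers: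
  assumes B: "eigenbasis T B"
  shows "\<exists>w\<in>B. \<exists>k. cmod k = 1 \<and> w = k *s f i"
proof (rule ccontr)
  assume no: "\<not> ?thesis"
  have "B \<subseteq> {x. braket (f i) x = 0}"
  proof clarify
    fix w assume w: "w \<in> B"
    obtain j k where jk: "cmod k = 1" "w = k *s f j" using eigenbasis_mem[OF B w] by blast
    then have "j \<noteq> i" using no w by blast
    then show "braket (f i) w = 0" using jk by (simp add: braket_scale_right orthonormal_eigenvectors)
  qed
  moreover have "vec.subspace {x. braket (f i) x = 0}"
    by (auto simp: vec.subspace_def braket_add_right braket_scale_right)
  ultimately have "vec.span B \<subseteq> {x. braket (f i) x = 0}" by (rule vec.span_minimal)
  then have "braket (f i) (f i) = 0" using B by (auto simp: eigenbasis_def orthonormal_basis_def)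
  then show False using unit by simp
qed

text \<open>Overlap moduli ignore phases, so an arbitrary eigenbasis may be replaced by the explicit
  frame \<open>f\<close>.\<close>

lemma unbiased_eigenbasis_iff:
  assumes B: "eigenbasis T B"
  shows "(\<forall>w\<in>B. (cmod (braket w v))\<^sup>2 = r) \<longleftrightarrow> (\<forall>i. (cmod (braket (f i) v))\<^sup>2 = r)"
proof (intro iffI ballI allI)
  fix i assume "\<forall>w\<in>B. (cmod (braket w v))\<^sup>2 = r"
  moreover obtain w k where "w \<in> B" "cmod k = 1" "w = k *s f i" using eigenbasis_covers[OF B] by blast
  ultimately show "(cmod (braket (f i) v))\<^sup>2 = r" by (force simp: braket_scale_left norm_mult)
next
  fix w assume "\<forall>i. (cmod (braket (f i) v))\<^sup>2 = r" "w \<in> B"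
  moreover obtain i k where "cmod k = 1" "w = k *s f i" using eigenbasis_mem[OF B \<open>w \<in> B\<close>] by blast
  ultimately show "(cmod (braket w v))\<^sup>2 = r" by (simp add: braket_scale_left norm_mult)
qed

end

subsection \<open>Weyl operators\<close>

lemma X6_apply: "X6 *v v = (\<chi> i. v $ (i - 1))"
proof -
  have "(\<Sum>j\<in>UNIV. (if i = j + 1 then 1 else 0) * v $ j) = v $ (i - 1)" for i :: 6
  proof -
    have "(if i = j + 1 then 1 else 0) * v $ j = (if j = i - 1 then v $ j else 0)" for j
      by (auto simp: algebra_simps)
    then show ?thesis by simp
  qed
  then show ?thesis by (simp add: X6_def matrix_vector_mult_def vec_eq_iff)
qed

lemma Z6_apply: "Z6 *v v = (\<chi> i. chi6 i * v $ i)"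
proof -
  have "(\<Sum>j\<in>UNIV. (if i = j then omega6 ^ nat (Rep_bit0 j) else 0) * v $ j) = chi6 i * v $ i" for i :: 6
  proof -
    have "(if i = j then omega6 ^ nat (Rep_bit0 j) else 0) * v $ j = (if i = j then chi6 i * v $ i else 0)" for j
      by (simp add: chi6_def)
    then show ?thesis by simp
  qed
  then show ?thesis by (simp add: Z6_def matrix_vector_mult_def vec_eq_iff)
qed

lemma mat_power_apply: "mat_power A n *v v = (((*v) A) ^^ n) v"
  by (induction n) (simp_all add: mat_power_def matrix_vector_mul_assoc[symmetric])

lemma matrix_inv_apply:
  fixes A :: "complex ^ 'n ^ 'n"
  assumes "\<And>v. A *v g v = v"
  shows "matrix_inv A *v v = g v"
proof -
  have "surj ((*v) A)" using assms by (metis surjI)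
  then obtain B where "A ** B = mat 1" using matrix_right_invertible_surjective by blast
  then have "\<exists>B. A ** B = mat 1 \<and> B ** A = mat 1" using matrix_left_right_inverse by blast
  then have "matrix_inv A ** A = mat 1" unfolding matrix_inv_def by (rule someI2_ex) simp
  then have "matrix_inv A *v (A *v g v) = g v" by (simp add: matrix_vector_mul_assoc)
  then show ?thesis by (simp add: assms)
qed

lemma mat_powi_X6_apply: "mat_powi X6 a *v v = (\<chi> i. v $ (i - of_int a))"
proof (cases "a \<ge> 0")
  case True
  have "(((*v) X6) ^^ n) v = (\<chi> i. v $ (i - of_nat n))" for n
    by (induction n) (simp_all add: X6_apply vec_eq_iff algebra_simps)
  then show ?thesis using True by (simp add: mat_powi_def mat_power_apply)
next
  case False
  have "matrix_inv X6 *v v = (\<chi> i. v $ (i + 1))" for v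
    by (rule matrix_inv_apply) (simp add: X6_apply vec_eq_iff)
  then have "(((*v) (matrix_inv X6)) ^^ n) v = (\<chi> i. v $ (i + of_nat n))" for n
    by (induction n) (simp_all add: vec_eq_iff algebra_simps)
  moreover have "of_nat (nat (- a)) = (- of_int a :: 6)" using False
    by (metis linorder_not_le nat_eq_iff of_int_minus of_int_of_nat_eq neg_0_le_iff_le order_less_imp_le)
  ultimately show ?thesis using False by (simp add: mat_powi_def mat_power_apply)
qed

lemma mat_powi_Z6_apply: "mat_powi Z6 b *v v = (\<chi> i. chi6 (of_int b * i) * v $ i)"
proof (cases "b \<ge> 0")
  case True
  have "(((*v) Z6) ^^ n) v = (\<chi> i. chi6 (of_nat n * i) * v $ i)" for n
    by (induction n) (simp_all add: Z6_apply vec_eq_iff distrib_right chi6_add mult.assoc)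
  then show ?thesis using True by (simp add: mat_powi_def mat_power_apply)
next
  case False
  have minus: "chi6 (- i - x) = cnj (chi6 i) * cnj (chi6 x)" for i x
    by (simp flip: chi6_minus chi6_add)
  have "matrix_inv Z6 *v v = (\<chi> i. chi6 (- i) * v $ i)" for v
    by (rule matrix_inv_apply) (simp add: Z6_apply vec_eq_iff mult.assoc[symmetric] chi6_add[symmetric])
  then have "(((*v) (matrix_inv Z6)) ^^ n) v = (\<chi> i. chi6 (- (of_nat n * i)) * v $ i)" for n
    by (induction n) (simp_all add: vec_eq_iff distrib_right minus chi6_minus chi6_add mult.assoc)
  moreover have "of_nat (nat (- b)) = (- of_int b :: 6)" using False
    by (metis linorder_not_le nat_eq_iff of_int_minus of_int_of_nat_eq neg_0_le_iff_le order_less_imp_le)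
  ultimately show ?thesis using False by (simp add: mat_powi_def mat_power_apply)
qed

definition weyl :: "int \<Rightarrow> int \<Rightarrow> complex ^ 6 ^ 6"
  where "weyl a b = mat_powi X6 a ** mat_powi Z6 b"

lemma weyl_apply: "weyl a b *v v = (\<chi> i. chi6 (of_int b * (i - of_int a)) * v $ (i - of_int a))"
  by (simp add: weyl_def matrix_vector_mul_assoc[symmetric] mat_powi_X6_apply mat_powi_Z6_apply)

lemma chi6_cnj_mult: "cnj (chi6 k) * chi6 k = 1"
  using norm_eq_1_iff[of "chi6 k"] by (simp add: mult.commute)

lemma weyl_isometry: "braket (weyl a b *v x) (weyl a b *v y) = braket x y"
proof -
  have "braket (weyl a b *v x) (weyl a b *v y) =
      (\<Sum>i\<in>UNIV. cnj (x $ (i - of_int a)) * y $ (i - of_int a))"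
    unfolding braket_def
  proof (rule sum.cong)
    fix i :: 6
    let ?c = "chi6 (of_int b * (i - of_int a))"
    have "cnj (?c * x $ (i - of_int a)) * (?c * y $ (i - of_int a)) =
        (cnj ?c * ?c) * (cnj (x $ (i - of_int a)) * y $ (i - of_int a))"
      by (simp add: mult_ac)
    then show "cnj ((weyl a b *v x) $ i) * (weyl a b *v y) $ i = cnj (x $ (i - of_int a)) * y $ (i - of_int a)"
      by (simp add: weyl_apply chi6_cnj_mult)
  qed simp
  also have "\<dots> = braket x y"
    unfolding braket_def
    by (rule sum.reindex_bij_witness[of _ "\<lambda>i. i + of_int a" "\<lambda>i. i - of_int a"]) auto
  finally show ?thesis .
qed

text \<open>The discrete Heisenberg relation: the phase is \<open>chi6\<close> at minus the
  determinant of the exponents.\<close>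

lemma weyl_commute:
  assumes "[a * b' - a' * b = 1] (mod 6)"
  shows "weyl a b *v (weyl a' b' *v x) = chi6 (- 1) *s (weyl a' b' *v (weyl a b *v x))"
proof -
  have "of_int (a * b' - a' * b) = (of_int 1 :: 6)" using assms by (simp only: of_int_6_eq_iff)
  then have 1: "of_int a * of_int b' - of_int a' * of_int b = (1 :: 6)" by simp
  have "chi6 (of_int b * (i - of_int a)) * chi6 (of_int b' * (i - of_int a - of_int a'))
      = chi6 (- 1) * (chi6 (of_int b' * (i - of_int a')) * chi6 (of_int b * (i - of_int a' - of_int a)))" for i
    unfolding chi6_add[symmetric]
    by (rule arg_cong[of _ _ chi6]) (simp add: 1[symmetric] algebra_simps)
  moreover have swap: "i - of_int a' - of_int a = i - of_int a - of_int a'" for i :: 6 by simp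
  ultimately have "(weyl a b *v (weyl a' b' *v x)) $ i = (chi6 (- 1) *s (weyl a' b' *v (weyl a b *v x))) $ i" for i
    unfolding weyl_apply vector_smult_component vec_lambda_beta mult.assoc[symmetric]
    by (simp only: swap mult.assoc)
  then show ?thesis by (simp add: vec_eq_iff)
qed

lemma sixth_root_of_phase:
  assumes "cmod k = 1"
  obtains c where "cmod c = 1" "c ^ 6 = k"
proof
  show "cmod (cis (Arg k / 6)) = 1" by simp
  have "cis (Arg k / 6) ^ 6 = cis (Arg k)" unfolding Complex.DeMoivre by simp
  moreover have "k \<noteq> 0" using assms by auto
  ultimately show "cis (Arg k / 6) ^ 6 = k" using assms by (simp add: cis_Arg sgn_eq)
qed

text \<open>By the commutation relation, \<open>weyl a' b'\<close> carries each eigenline of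
  \<open>weyl a b\<close> to the next one, so a single eigenvector from \<open>B\<close> generates
  the frame.\<close>

lemma weyl_frame:
  assumes ab: "[a * b' - a' * b = 1] (mod 6)" and B: "eigenbasis (weyl a b) B"
  obtains u :: "6 \<Rightarrow> complex ^ 6" and m c where
    "\<And>i. weyl a b *v u i = (m * chi6 (- i)) *s u i" "\<And>i. weyl a' b' *v u i = c *s u (i + 1)"
    "\<And>i. braket (u i) (u i) = 1" "m \<noteq> 0" "c \<noteq> 0"
proof -
  let ?T = "weyl a b" and ?T' = "weyl a' b'"
  have "B \<noteq> {}"
  proof
    assume "B = {}"
    then have "(UNIV :: (complex ^ 6) set) = {0}" using B by (auto simp: eigenbasis_def orthonormal_basis_def)
    then have "axis (0 :: 6) (1 :: complex) = 0" by blast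
    then show False by (simp add: axis_eq_0_iff)
  qed
  then obtain v where "v \<in> B" by blast
  then have vv: "braket v v = 1" using B by (auto simp: eigenbasis_def orthonormal_basis_def)
  obtain m where Tv: "?T *v v = m *s v" using B \<open>v \<in> B\<close> by (auto simp: eigenbasis_def eigenvector_def)
  have m: "m \<noteq> 0" using weyl_isometry[of a b v v] vv by (auto simp: Tv)
  define w where "w n = (((*v) ?T') ^^ n) v" for n
  have w_Suc: "?T' *v w n = w (Suc n)" for n by (simp add: w_def)
  have ww: "braket (w n) (w n) = 1" for n
    by (induction n) (simp_all add: w_def vv weyl_isometry)
  have Tw: "?T *v w n = (m * chi6 (- of_nat n)) *s w n" for n
  proof (induction n)
    case 0
    then show ?case by (simp add: w_def Tv)
  next
    case (Suc n)
    have "?T *v w (Suc n) = chi6 (- 1) *s (?T' *v (?T *v w n))"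
      unfolding w_Suc[symmetric] by (rule weyl_commute[OF ab])
    also have "\<dots> = (chi6 (- 1) * (m * chi6 (- of_nat n))) *s w (Suc n)"
      unfolding Suc by (simp add: w_Suc vector_scalar_commute)
    also have "chi6 (- 1) * (m * chi6 (- of_nat n)) = m * chi6 (- of_nat (Suc n))"
      by (simp add: mult.left_commute flip: chi6_add)
    finally show ?case .
  qed
  define g where "g i = w (nat (Rep_bit0 i))" for i :: 6
  have rep: "of_nat (nat (Rep_bit0 i)) = i" for i :: 6
    using forall_6[of "\<lambda>i. of_nat (nat (Rep_bit0 i)) = i"]
    by (simp add: bit0.Rep_numeral bit0.Rep_0 bit0.Rep_1)
  interpret simple_spectrum ?T g "\<lambda>i. m * chi6 (- i)"
  proof
    show "?T *v g i = (m * chi6 (- i)) *s g i" for i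
      using Tw[of "nat (Rep_bit0 i)"] by (simp add: g_def rep)
  qed (use m in \<open>auto simp: weyl_isometry g_def ww chi6_inj\<close>)
  \<comment> \<open>After six steps the eigenvalue is the initial one, so the orbit returns to the
    line of \<open>w 0\<close>, up to a phase.\<close>
  have "?T *v w 6 = (m * chi6 (- 0)) *s w 6"
    using Tw[of 6] by (simp add: chi6_minus omega6_powers)
  then have w6: "w 6 = braket (g 0) (w 6) *s g 0" by (rule eigenvector_scale)
  then obtain c where c: "cmod c = 1" "c ^ 6 = braket (g 0) (w 6)"
    using norm_scale[OF ww] sixth_root_of_phase by metis
  have cc: "cnj c * c = 1" using c norm_eq_1_iff[of c] by (simp add: mult.commute)
  \<comment> \<open>Spreads the return phase evenly over the six steps, so that the shift closes up
    with one factor \<open>c\<close> everywhere.\<close>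
  define u where "u i = cnj c ^ nat (Rep_bit0 i) *s g i" for i
  show thesis
  proof (rule that[of u m c])
    show "?T *v u i = (m * chi6 (- i)) *s u i" for i
      by (simp add: u_def vector_scalar_commute eigen mult_ac)
    show "braket (u i) (u i) = 1" for i
    proof -
      have "braket (u i) (u i) = (cnj c * c) ^ nat (Rep_bit0 i)"
        unfolding power_mult_distrib by (simp add: u_def braket_scale_left braket_scale_right unit)
      then show ?thesis by (simp add: cc)
    qed
    define U where "U n = cnj c ^ n *s w n" for n
    have u: "u 0 = U 0" "u 1 = U 1" "u 2 = U 2" "u 3 = U 3" "u 4 = U 4" "u 5 = U 5"
      by (simp_all add: u_def g_def U_def bit0.Rep_numeral bit0.Rep_0 bit0.Rep_1)
    have step: "?T' *v U n = c *s U (Suc n)" for n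
    proof -
      have "c * cnj c ^ Suc n = (cnj c * c) * cnj c ^ n" by simp
      then show ?thesis by (simp add: U_def vector_scalar_commute w_Suc cc)
    qed
    have "w 6 = c ^ 6 *s w 0" using w6 c by (simp add: g_def bit0.Rep_0)
    then have "U 6 = (cnj c * c) ^ 6 *s w 0"
      by (simp only: U_def vector_smult_assoc power_mult_distrib)
    then have last: "U 6 = U 0" by (simp add: cc U_def)
    have "?T' *v u 0 = c *s u 1" "?T' *v u 1 = c *s u 2" "?T' *v u 2 = c *s u 3"
      "?T' *v u 3 = c *s u 4" "?T' *v u 4 = c *s u 5" "?T' *v u 5 = c *s u 0"
      using step[of 0] step[of 1] step[of 2] step[of 3] step[of 4] step[of 5] last
      unfolding u by (simp_all add: numeral_2_eq_2[symmetric])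
    moreover have "u 6 = u 0" by (rule arg_cong[of _ _ u]) simp
    ultimately have "\<forall>i. ?T' *v u i = c *s u (i + 1)"
      unfolding forall_6 by simp
    then show "?T' *v u i = c *s u (i + 1)" for i by blast
    show "m \<noteq> 0" by (rule m)
    show "c \<noteq> 0" using c by auto
  qed
qed

subsection \<open>Counting vectors and bases\<close>

lemma norm_code_vec: "c \<in> set codes \<Longrightarrow> braket (code_vec c) (code_vec c) = 1"
proof -
  assume "c \<in> set codes"
  then have "(cmod (code_vec c $ k))\<^sup>2 = 1 / 6" for k
    using biunimodular_code_vec by (simp add: biunimodular_def)
  then have "cnj (code_vec c $ k) * code_vec c $ k = complex_of_real (1 / 6)" for k
    by (metis complex_norm_square mult.commute)
  then have "braket (code_vec c) (code_vec c) = (\<Sum>k\<in>(UNIV :: 6 set). complex_of_real (1 / 6))"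
    by (simp only: braket_def)
  then show ?thesis by simp
qed

lemma orth_sym: "c \<in> set codes \<Longrightarrow> c' \<in> set codes \<Longrightarrow> orth c c' \<longleftrightarrow> orth c' c"
  by (metis cnj_braket complex_cnj_zero_iff orth_iff)

lemma code_vec_inequivalent:
  assumes c: "c \<in> set codes" "c' \<in> set codes"
    and eq: "\<And>d. d \<in> set codes \<Longrightarrow> braket (code_vec d) (code_vec c) = 0 \<longleftrightarrow> braket (code_vec d) (code_vec c') = 0"
  shows "c = c'"
proof -
  have "map (\<lambda>k. orth k c) codes = map (\<lambda>k. orth k c') codes"
    using c eq by (auto simp: orth_iff)
  then show ?thesis using orth_separates c by (auto simp: distinct_map inj_on_def)
qed

text \<open>All claims depend only on the Gram matrix and on \<open>S\<close> consisting of the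
  phase multiples of the 48 vectors, so they can be settled on codes.\<close>

lemma configuration_count:
  fixes h :: "code \<Rightarrow> complex ^ 6" and S V :: "(complex ^ 6) set"
  assumes gram: "\<And>c c'. c \<in> set codes \<Longrightarrow> c' \<in> set codes \<Longrightarrow>
      braket (h c) (h c') = braket (code_vec c) (code_vec c')"
    and hS: "\<And>c. c \<in> set codes \<Longrightarrow> h c \<in> S"
    and Sh: "\<And>v. v \<in> S \<Longrightarrow> \<exists>c\<in>set codes. \<exists>k. cmod k = 1 \<and> v = k *s h c"
    and V: "phase_representatives S V"
  shows "card V = 48" "card (bases_within V) = 16"
    "\<And>C v. C \<in> bases_within V \<Longrightarrow> v \<in> S \<Longrightarrow> \<exists>w\<in>C. (cmod (braket w v))\<^sup>2 \<in> {0, 1}"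
proof -
  define r where "r c = (SOME u. u \<in> V \<and> (\<exists>k. cmod k = 1 \<and> h c = k *s u))" for c
  have V': "V \<subseteq> S" "\<And>v. v \<in> S \<Longrightarrow> \<exists>!u. u \<in> V \<and> (\<exists>k. cmod k = 1 \<and> v = k *s u)"
    using V unfolding phase_representatives_def by blast+
  have "r c \<in> V \<and> (\<exists>k. cmod k = 1 \<and> h c = k *s r c)" if "c \<in> set codes" for c
    unfolding r_def by (rule someI_ex[OF ex1_implies_ex[OF V'(2)[OF hS[OF that]]]])
  then have rV: "\<And>c. c \<in> set codes \<Longrightarrow> r c \<in> V"
    and rh: "\<And>c. c \<in> set codes \<Longrightarrow> \<exists>k. cmod k = 1 \<and> h c = k *s r c" by blast+
  have hr: "\<exists>k. cmod k = 1 \<and> r c = k *s h c" if c: "c \<in> set codes" for c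
  proof -
    obtain k where k: "cmod k = 1" "h c = k *s r c" using rh[OF c] by blast
    have "cnj k * k = 1" using k norm_eq_1_iff[of k] by (simp add: mult.commute)
    then have "r c = cnj k *s h c" using k by simp
    then show ?thesis using k by (intro exI[of _ "cnj k"]) simp
  qed
  have braket_r: "cmod (braket (r c) (k *s h c')) = cmod (braket (code_vec c) (code_vec c'))"
    if c: "c \<in> set codes" "c' \<in> set codes" "cmod k = 1" for c c' k
  proof -
    obtain k' where "cmod k' = 1" "r c = k' *s h c" using hr[OF c(1)] by blast
    then show ?thesis
      using c by (simp add: braket_scale_left braket_scale_right norm_mult gram)
  qed
  \<comment> \<open>Equal representatives would have the same overlap moduli, hence the same
    orthogonality pattern, which determines the code.\<close>
  have inj: "inj_on r (set codes)"
  proof (rule inj_onI)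
    fix c c' assume c: "c \<in> set codes" "c' \<in> set codes" and "r c = r c'"
    obtain k where k: "cmod k = 1" "r c = k *s h c" using hr c by blast
    obtain k' where k': "cmod k' = 1" "r c' = k' *s h c'" using hr c by blast
    have "cmod (braket (code_vec d) (code_vec c)) = cmod (braket (code_vec d) (code_vec c'))"
      if d: "d \<in> set codes" for d
      using braket_r[OF d c(1) k(1)] braket_r[OF d c(2) k'(1)] k(2) k'(2) \<open>r c = r c'\<close> by simp
    then show "c = c'" using code_vec_inequivalent[OF c] by (metis norm_eq_zero)
  qed
  have V_eq: "V = r ` set codes"
  proof
    show "r ` set codes \<subseteq> V" using rV by blast
    show "V \<subseteq> r ` set codes"
    proof
      fix v assume v: "v \<in> V"
      then have vS: "v \<in> S" using V' by blast
      obtain c k where c: "c \<in> set codes" "cmod k = 1" "v = k *s h c" using Sh[OF vS] by blast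
      obtain k' where k': "cmod k' = 1" "h c = k' *s r c" using rh[OF c(1)] by blast
      have "cmod (k * k') = 1" "v = (k * k') *s r c" using c k' by (simp_all add: norm_mult)
      then have "r c \<in> V \<and> (\<exists>k. cmod k = 1 \<and> v = k *s r c)" using rV c(1) by blast
      moreover have "v \<in> V \<and> (\<exists>k. cmod k = 1 \<and> v = k *s v)"
        using v by (intro conjI exI[of _ 1]) simp_all
      ultimately have "v = r c" using V'(2)[OF vS] by blast
      then show "v \<in> r ` set codes" using c(1) by blast
    qed
  qed
  have "card V = card (set codes)" unfolding V_eq using inj by (rule card_image)
  then show "card V = 48" using distinct_card[OF distinct_codes] length_codes by simp
  have self: "braket (r c) (r c) = 1" if "c \<in> set codes" for c
  proof -
    obtain k where k: "cmod k = 1" "r c = k *s h c" using hr[OF \<open>c \<in> set codes\<close>] by blast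
    have "braket (r c) (r c) = (k * cnj k) * braket (h c) (h c)"
      by (simp add: k braket_scale_left braket_scale_right mult_ac)
    also have "\<dots> = 1" using k(1)[unfolded norm_eq_1_iff] gram[OF that that] norm_code_vec[OF that] by simp
    finally show ?thesis .
  qed
  have orth_r: "braket (r c) (r c') = 0 \<longleftrightarrow> orth c c'" if "c \<in> set codes" "c' \<in> set codes" for c c'
    using braket_r[OF that] hr[OF that(2)] that by (metis norm_eq_zero orth_iff)
  define \<K> where "\<K> = {K. K \<subseteq> set codes \<and> card K = 6 \<and> (\<forall>x\<in>K. \<forall>y\<in>K. x \<noteq> y \<longrightarrow> orth x y)}"
  have basis_r: "orthonormal_basis (r ` K) \<longleftrightarrow> K \<in> \<K>" if K: "K \<subseteq> set codes" for K
  proof -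
    have "card (r ` K) = card K" using inj_on_subset[OF inj K] by (rule card_image)
    moreover have "orthonormal (r ` K) \<longleftrightarrow> (\<forall>x\<in>K. \<forall>y\<in>K. x \<noteq> y \<longrightarrow> orth x y)"
    proof -
      have "braket (r x) (r y) = (if r x = r y then 1 else 0) \<longleftrightarrow> (x \<noteq> y \<longrightarrow> orth x y)"
        if "x \<in> K" "y \<in> K" for x y
      proof -
        have xy: "x \<in> set codes" "y \<in> set codes" using that K by auto
        then have "r x = r y \<longleftrightarrow> x = y" using inj by (simp add: inj_on_eq_iff)
        then show ?thesis using orth_r[OF xy] self[OF xy(1)] by auto
      qed
      then show ?thesis unfolding orthonormal_def by auto
    qed
    ultimately show ?thesis unfolding orthonormal_basis_iff \<K>_def using K by auto
  qed
  have bases: "bases_within V = (`) r ` \<K>"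
  proof (intro equalityI subsetI)
    fix C assume "C \<in> bases_within V"
    then have C: "C \<subseteq> r ` set codes" "orthonormal_basis C" by (auto simp: bases_within_def V_eq)
    then obtain K where "K \<subseteq> set codes" "C = r ` K" by (auto simp: subset_image_iff)
    then show "C \<in> (`) r ` \<K>" using basis_r C by blast
  next
    fix C assume "C \<in> (`) r ` \<K>"
    then obtain K where "K \<in> \<K>" "C = r ` K" by blast
    then show "C \<in> bases_within V" using basis_r[of K] by (auto simp: bases_within_def V_eq \<K>_def)
  qed
  have "inj_on ((`) r) \<K>"
    by (rule inj_on_subset[OF inj_on_image_Pow[OF inj]]) (auto simp: \<K>_def)
  then have "card (bases_within V) = card \<K>" unfolding bases by (rule card_image)
  also have "\<dots> = length (cliques orth 6 codes)"
    unfolding \<K>_def by (rule card_cliques[OF distinct_codes orth_sym])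
  finally show "card (bases_within V) = 16" by (simp add: length_cliques)
  fix C v assume C: "C \<in> bases_within V" and v: "v \<in> S"
  obtain K where K: "K \<in> \<K>" "C = r ` K" using C unfolding bases by blast
  then have Kc: "K \<subseteq> set codes" by (simp add: \<K>_def)
  have "\<K> = set ` set (cliques orth 6 codes)"
    unfolding \<K>_def by (rule set_cliques[OF distinct_codes orth_sym, symmetric])
  then obtain K' where K': "K' \<in> set (cliques orth 6 codes)" "K = set K'" using K by blast
  obtain c k where c: "c \<in> set codes" "cmod k = 1" "v = k *s h c" using Sh[OF v] by blast
  obtain d where d: "d \<in> K" "d = c \<or> orth d c" using cliques_maximal K' c(1) by blast
  then have "d \<in> set codes" using Kc by blast
  then have "cmod (braket (r d) v) \<in> {0, 1}"
    unfolding c(3) using braket_r[OF \<open>d \<in> set codes\<close> c(1,2)] d(2) orth_iff[of d c] norm_code_vec[OF c(1)] c(1)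
    by auto
  then have "(cmod (braket (r d) v))\<^sup>2 \<in> {0, 1}" by auto
  then show "\<exists>w\<in>C. (cmod (braket w v))\<^sup>2 \<in> {0, 1}" using d(1) K(2) by blast
qed

section \<open>Transfer to the two given eigenbases\<close>

lemma matrix_vector_mult_sum_right:
  fixes A :: "'a::comm_ring_1 ^ 'n ^ 'm"
  shows "A *v (\<Sum>i\<in>I. f i) = (\<Sum>i\<in>I. A *v f i)"
  by (induction I rule: infinite_finite_induct) (simp_all add: matrix_vector_right_distrib)

text \<open>In the frame \<open>u\<close> the basis \<open>B\<close> is, up to phases, the standard
  basis. The second operator is a multiple of the cyclic shift, so \<open>B'\<close> is the Fourier
  basis.\<close>

lemma weyl_coordinates:
  assumes ab: "[a * b' - a' * b = 1] (mod 6)"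
    and B: "eigenbasis (weyl a b) B" and B': "eigenbasis (weyl a' b') B'"
  obtains u :: "6 \<Rightarrow> complex ^ 6" where
    "\<And>i j. braket (u i) (u j) = (if i = j then 1 else 0)"
    "\<And>v. (\<forall>w\<in>B \<union> B'. (cmod (braket w v))\<^sup>2 = 1 / 6) \<longleftrightarrow> biunimodular (\<chi> k. braket (u k) v)"
    "mutually_unbiased B B'"
proof -
  obtain u m c where Tu: "\<And>i. weyl a b *v u i = (m * chi6 (- i)) *s u i"
    and T'u: "\<And>i. weyl a' b' *v u i = c *s u (i + 1)"
    and unit: "\<And>i. braket (u i) (u i) = 1" and mc: "m \<noteq> 0" "c \<noteq> 0"
    by (rule weyl_frame[OF ab B]) (rule that)
  interpret T: simple_spectrum "weyl a b" u "\<lambda>i. m * chi6 (- i)"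
    by unfold_locales (use Tu unit mc in \<open>auto simp: weyl_isometry chi6_inj\<close>)
  note on = T.orthonormal_eigenvectors
  \<comment> \<open>The Fourier vectors of the frame; the cyclic shift multiplies \<open>f l\<close>
    by \<open>chi6 l\<close>.\<close>
  define f where "f l = (\<Sum>k\<in>UNIV. (chi6 (- (k * l)) / complex_of_real (sqrt 6)) *s u k)" for l
  have s6: "complex_of_real (sqrt 6) * complex_of_real (sqrt 6) = 6"
    by (metis of_real_mult of_real_numeral real_sqrt_mult_self abs_numeral)
  have coeff: "braket (u k) (f l) = chi6 (- (k * l)) / complex_of_real (sqrt 6)" for k l
  proof -
    have "braket (u k) (f l) = (\<Sum>j\<in>UNIV. if j = k then chi6 (- (k * l)) / complex_of_real (sqrt 6) else 0)"
      unfolding f_def braket_sum_right by (intro sum.cong) (auto simp: braket_scale_right on)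
    then show ?thesis by simp
  qed
  interpret T': simple_spectrum "weyl a' b'" f "\<lambda>l. c * chi6 l"
  proof
    show "weyl a' b' *v f l = (c * chi6 l) *s f l" for l
    proof -
      have "weyl a' b' *v f l = (\<Sum>k\<in>UNIV. (c * chi6 (- (k * l)) / complex_of_real (sqrt 6)) *s u (k + 1))"
        unfolding f_def by (simp add: matrix_vector_mult_sum_right vector_scalar_commute T'u mult.commute)
      also have "\<dots> = (\<Sum>k\<in>UNIV. (c * chi6 (- ((k - 1) * l)) / complex_of_real (sqrt 6)) *s u k)"
        by (rule sum.reindex_bij_witness[of _ "\<lambda>k. k - 1" "\<lambda>k. k + 1"]) auto
      also have "\<dots> = (\<Sum>k\<in>UNIV. (c * chi6 l) *s ((chi6 (- (k * l)) / complex_of_real (sqrt 6)) *s u k))"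
      proof (rule sum.cong)
        fix k :: 6
        have "chi6 (- ((k - 1) * l)) = chi6 l * chi6 (- (k * l))"
          by (simp add: algebra_simps flip: chi6_add)
        then show "(c * chi6 (- ((k - 1) * l)) / complex_of_real (sqrt 6)) *s u k
            = (c * chi6 l) *s ((chi6 (- (k * l)) / complex_of_real (sqrt 6)) *s u k)"
          by (simp add: mult_ac)
      qed simp
      finally show ?thesis by (simp add: f_def vec.scale_sum_right)
    qed
    show "braket (f l) (f l) = 1" for l
      unfolding parseval[OF on, of "f l" "f l"] coeff
      by (simp add: chi6_cnj_mult s6)
  qed (use mc in \<open>auto simp: weyl_isometry chi6_inj\<close>)
  have fv: "braket (f l) v = fourier6 (\<chi> k. braket (u k) v) l / complex_of_real (sqrt 6)" for l v
    unfolding parseval[OF on, of "f l" v] coeff fourier6_def sum_divide_distrib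
    by (simp add: chi6_minus)
  have fn: "(cmod (x / complex_of_real (sqrt 6)))\<^sup>2 = 1 / 6 \<longleftrightarrow> (cmod x)\<^sup>2 = 1" for x
    by (simp add: norm_divide power_divide)
  show thesis
  proof (rule that[of u])
    show "braket (u i) (u j) = (if i = j then 1 else 0)" for i j by (rule on)
    show "(\<forall>w\<in>B \<union> B'. (cmod (braket w v))\<^sup>2 = 1 / 6) \<longleftrightarrow> biunimodular (\<chi> k. braket (u k) v)" for v
      using T.unbiased_eigenbasis_iff[OF B, of v "1 / 6"] T'.unbiased_eigenbasis_iff[OF B', of v "1 / 6"]
      unfolding biunimodular_def fv fn by (auto simp only: ball_Un vec_lambda_beta)
    show "mutually_unbiased B B'"
      unfolding mutually_unbiased_def
    proof (intro ballI)
      fix x y assume xy: "x \<in> B" "y \<in> B'"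
      obtain i k where i: "cmod k = 1" "x = k *s u i" using T.eigenbasis_mem[OF B xy(1)] by blast
      obtain l k' where l: "cmod k' = 1" "y = k' *s f l" using T'.eigenbasis_mem[OF B' xy(2)] by blast
      show "(cmod (braket x y))\<^sup>2 = 1 / real CARD(6)"
        using i l by (simp add: braket_scale_left braket_scale_right coeff norm_mult norm_divide power_divide)
    qed
  qed
qed

text \<open>For \<open>a\<close> divisible by 6 the operator is diagonal, and the determinant
  condition makes \<open>b\<close> invertible modulo 6. So its spectrum is simple and
  \<open>B\<close> is the standard basis up to phases.\<close>

lemma first_component_flat:
  assumes ab: "[a * b' - a' * b = 1] (mod 6)" and a: "[a = 0] (mod 6)"
    and B: "eigenbasis (weyl a b) B" and v: "\<forall>w\<in>B. (cmod (braket w v))\<^sup>2 = 1 / 6"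
  shows "(cmod (v $ 0))\<^sup>2 = 1 / 6"
proof -
  have a0: "of_int a = (0 :: 6)" using a of_int_6_eq_iff[of a 0] by simp
  have "of_int (a * b' - a' * b) = (of_int 1 :: 6)" using ab by (simp only: of_int_6_eq_iff)
  then have unit: "- (of_int a') * of_int b = (1 :: 6)" using a0 by simp
  have ax: "braket (axis i 1) x = x $ i" for i :: 6 and x
  proof -
    have "braket (axis i 1) x = (\<Sum>j\<in>UNIV. if j = i then x $ i else 0)"
      unfolding braket_def by (intro sum.cong) (auto simp: axis_def)
    then show ?thesis by simp
  qed
  interpret simple_spectrum "weyl a b" "\<lambda>i. axis i 1" "\<lambda>i. chi6 (of_int b * i)"
  proof
    show "weyl a b *v axis i 1 = chi6 (of_int b * i) *s axis i 1" for i
      by (auto simp: weyl_apply a0 vec_eq_iff axis_def)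
    show "i = j" if "chi6 (of_int b * i) = chi6 (of_int b * j)" for i j
    proof -
      have "- of_int a' * of_int b * i = - of_int a' * of_int b * j"
        using that by (simp add: chi6_inj mult.assoc)
      then show ?thesis unfolding unit by simp
    qed
    show "braket (axis i 1) (axis i (1 :: complex)) = 1" for i :: 6 unfolding ax by (simp add: axis_def)
  qed (rule weyl_isometry)
  show ?thesis using unbiased_eigenbasis_iff[OF B, of v "1 / 6"] v ax by simp
qed

text \<open>The representative arises by dividing out the phase of the first component.\<close>

lemma phase_representatives_first_component:
  fixes S :: "(complex ^ 'n::{finite,zero}) set"
  assumes r: "r > 0" and flat: "\<And>v. v \<in> S \<Longrightarrow> cmod (v $ 0) = r"
    and closed: "\<And>k v. cmod k = 1 \<Longrightarrow> v \<in> S \<Longrightarrow> k *s v \<in> S"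
  shows "phase_representatives S {v \<in> S. v $ 0 = complex_of_real r}"
  unfolding phase_representatives_def
proof (intro conjI ballI)
  fix v assume v: "v \<in> S"
  define k where "k = v $ 0 / complex_of_real r"
  have k: "cmod k = 1" using flat[OF v] r by (simp add: k_def norm_divide)
  then have kk: "k * cnj k = 1" "cnj k * k = 1" unfolding norm_eq_1_iff by (simp_all add: mult.commute)
  show "\<exists>!u. u \<in> {v \<in> S. v $ 0 = complex_of_real r} \<and> (\<exists>c. cmod c = 1 \<and> v = c *s u)"
  proof (rule ex1I[of _ "cnj k *s v"])
    have "(cnj k *s v) $ 0 = cnj k * k * complex_of_real r" using r by (simp add: k_def)
    then have "cnj k *s v \<in> {v \<in> S. v $ 0 = complex_of_real r}" using closed[of "cnj k" v] v k kk by simp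
    moreover have "v = k *s (cnj k *s v)" using kk by simp
    ultimately show "cnj k *s v \<in> {v \<in> S. v $ 0 = complex_of_real r} \<and> (\<exists>c. cmod c = 1 \<and> v = c *s (cnj k *s v))"
      using k by blast
  next
    fix u assume u: "u \<in> {v \<in> S. v $ 0 = complex_of_real r} \<and> (\<exists>c. cmod c = 1 \<and> v = c *s u)"
    then obtain c where c: "u $ 0 = complex_of_real r" "v = c *s u" by blast
    then have "c = k" using r by (simp add: k_def)
    then show "u = cnj k *s v" using c kk by simp
  qed
qed blast

text \<open>Prescribing the first component selects one vector per phase class when one of the
  operators is diagonal, that is, \<open>a\<close> or \<open>a'\<close> vanishes modulo 6. Otherwise
  its modulus need not be 1 / sqrt 6, and solutions are counted up to a global phase.\<close>

theorem corollary1: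
  fixes a b a' b' :: int
    and B B' S V :: "(complex ^ 6) set"
  assumes "[a * b' - a' * b = 1] (mod 6)"
    and "eigenbasis (mat_powi X6 a ** mat_powi Z6 b) B"
    and "eigenbasis (mat_powi X6 a' ** mat_powi Z6 b') B'"
    and "S = {v. norm v = 1 \<and> (\<forall>w\<in>B \<union> B'. (cmod (braket w v))\<^sup>2 = 1 / 6)}"
    and "([a = 0] (mod 6) \<or> [a' = 0] (mod 6)) \<and> V = {v \<in> S. v $ 0 = complex_of_real (1 / sqrt 6)}
      \<or> phase_representatives S V"
  shows "card V = 48
    \<and> card (bases_within V) = 16
    \<and> (\<forall>C\<in>bases_within V.
        mutually_unbiased B B' \<and> mutually_unbiased B C \<and> mutually_unbiased B' C
        \<and> \<not> (\<exists>\<psi>. unbiased \<psi> B \<and> unbiased \<psi> B' \<and> unbiased \<psi> C))"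
proof -
  have B: "eigenbasis (weyl a b) B" and B': "eigenbasis (weyl a' b') B'"
    using assms(2,3) by (simp_all add: weyl_def)
  obtain u where on: "\<And>i j. braket (u i) (u j) = (if i = j then 1 else 0)"
    and unb: "\<And>v. (\<forall>w\<in>B \<union> B'. (cmod (braket w v))\<^sup>2 = 1 / 6) \<longleftrightarrow> biunimodular (\<chi> k. braket (u k) v)"
    and mub: "mutually_unbiased B B'"
    by (rule weyl_coordinates[OF assms(1) B B']) (rule that)
  \<comment> \<open>By Parseval the six squared coordinates 1/6 add up to 1. Maximality relies on
    this, since \<open>\<psi>\<close> is not assumed to be normalised.\<close>
  have norm1: "norm v = 1" if "biunimodular (\<chi> k. braket (u k) v)" for v
  proof -
    have "(cmod (braket (u k) v))\<^sup>2 = 1 / 6" for k using that by (simp add: biunimodular_def)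
    then have "cnj (braket (u k) v) * braket (u k) v = complex_of_real (1 / 6)" for k
      by (metis complex_norm_square mult.commute)
    then have "braket v v = (\<Sum>k\<in>(UNIV :: 6 set). complex_of_real (1 / 6))"
      by (simp only: parseval[OF on, of v v])
    then have "complex_of_real ((norm v)\<^sup>2) = 1" unfolding braket_self by simp
    then have "(norm v)\<^sup>2 = 1" by (simp only: of_real_eq_1_iff)
    then show ?thesis by (simp add: power2_eq_1_iff) (smt (verit) norm_ge_zero)
  qed
  have S: "v \<in> S \<longleftrightarrow> biunimodular (\<chi> k. braket (u k) v)" for v
    using norm1[of v] unb[of v] unfolding assms(4) by blast
  have V: "phase_representatives S V"
  proof (rule disjE[OF assms(5)])
    assume h: "([a = 0] (mod 6) \<or> [a' = 0] (mod 6)) \<and> V = {v \<in> S. v $ 0 = complex_of_real (1 / sqrt 6)}"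
    have "phase_representatives S {v \<in> S. v $ 0 = complex_of_real (1 / sqrt 6)}"
    proof (rule phase_representatives_first_component)
      fix v assume "v \<in> S"
      then have "\<forall>w\<in>B. (cmod (braket w v))\<^sup>2 = 1 / 6" "\<forall>w\<in>B'. (cmod (braket w v))\<^sup>2 = 1 / 6"
        unfolding assms(4) by blast+
      \<comment> \<open>The determinant rewritten with the two operators exchanged, so that
        \<open>first_component_flat\<close> also covers \<open>B'\<close>.\<close>
      moreover have "[a' * (- b) - (- a) * b' = 1] (mod 6)" using assms(1) by (simp add: algebra_simps)
      ultimately have "(cmod (v $ 0))\<^sup>2 = 1 / 6"
        using h first_component_flat[OF assms(1) _ B] first_component_flat[of a' "- b" "- a" b', OF _ _ B'] by blast
      then show "cmod (v $ 0) = 1 / sqrt 6" by (metis norm_ge_zero real_sqrt_divide real_sqrt_one real_sqrt_unique)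
    next
      fix k :: complex and v assume "cmod k = 1" "v \<in> S"
      then show "k *s v \<in> S"
        unfolding S biunimodular_def fourier6_def
        by (simp add: braket_scale_right norm_mult mult.left_commute[of _ k] flip: sum_distrib_left)
    qed simp
    then show ?thesis using h by simp
  qed
  \<comment> \<open>The solutions carried over from the standard frame to the frame
    \<open>u\<close>, which preserves brakets.\<close>
  define h where "h c = (\<Sum>k\<in>UNIV. code_vec c $ k *s u k)" for c
  have coord: "braket (u k) (h c) = code_vec c $ k" for k c
  proof -
    have "braket (u k) (h c) = (\<Sum>j\<in>UNIV. if j = k then code_vec c $ k else 0)"
      unfolding h_def braket_sum_right by (intro sum.cong) (auto simp: braket_scale_right on)
    then show ?thesis by simp
  qed
  have gram: "braket (h c) (h c') = braket (code_vec c) (code_vec c')" for c c'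
    unfolding parseval[OF on, of "h c"] coord braket_def[of "code_vec c"] ..
  have hS: "h c \<in> S" if "c \<in> set codes" for c
    unfolding S coord using biunimodular_code_vec[OF that] by (simp add: vec_lambda_eta)
  have Sh: "\<exists>c\<in>set codes. \<exists>k. cmod k = 1 \<and> v = k *s h c" if v: "v \<in> S" for v
  proof -
    obtain c k where c: "c \<in> set codes" "cmod k = 1" "(\<chi> k. braket (u k) v) = k *s code_vec c"
      using biunimodular_classification v unfolding S by blast
    have "braket (u j) v = k * code_vec c $ j" for j
      using c(3) by (simp add: vec_eq_iff)
    then have "v = (\<Sum>j\<in>UNIV. (k * code_vec c $ j) *s u j)"
      using orthonormal_expansion[OF on, of v] by simp
    also have "\<dots> = k *s h c" unfolding h_def by (simp add: vec.scale_sum_right)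
    finally show ?thesis using c by blast
  qed
  have count: "card V = 48" "card (bases_within V) = 16"
    "\<And>C v. C \<in> bases_within V \<Longrightarrow> v \<in> S \<Longrightarrow> \<exists>w\<in>C. (cmod (braket w v))\<^sup>2 \<in> {0, 1}"
    by (rule configuration_count[OF gram hS Sh V]; assumption)+
  have C: "mutually_unbiased B C \<and> mutually_unbiased B' C" if "C \<in> bases_within V" for C
  proof -
    have "C \<subseteq> S" using that V unfolding bases_within_def phase_representatives_def by blast
    then have "\<forall>v\<in>C. \<forall>w\<in>B \<union> B'. (cmod (braket w v))\<^sup>2 = 1 / 6" unfolding assms(4) by blast
    then show ?thesis by (auto simp: mutually_unbiased_def)
  qed
  have max: "\<not> (unbiased \<psi> B \<and> unbiased \<psi> B' \<and> unbiased \<psi> C)" if CV: "C \<in> bases_within V" for C \<psi>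
  proof
    assume unb': "unbiased \<psi> B \<and> unbiased \<psi> B' \<and> unbiased \<psi> C"
    then have "\<psi> \<in> S" unfolding S unb[symmetric] by (auto simp: unbiased_def)
    then obtain w where "w \<in> C" "(cmod (braket w \<psi>))\<^sup>2 \<in> {0, 1}" using count(3) CV by blast
    moreover have "(cmod (braket w \<psi>))\<^sup>2 = 1 / 6" using unb' \<open>w \<in> C\<close> by (auto simp: unbiased_def)
    ultimately show False by auto
  qed
  show ?thesis using count(1,2) mub C max by blast
qed

end
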